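(* Let $(X,\mathscr A,\mu)$ be a $\sigma$-finite measure space and let $\phi$ be a nonsingular transformation of $X$. Then $C_\phi$ is normal if and only if $C_\phi$ is formally normal.
   Context: $L^2(\mu)$ is the complex Hilbert space of square integrable complex functions on $X$. A transformation $\phi\colon X\to X$ is nonsingular if $\phi^{-1}(\Delta)\in\mathscr A$ for all $\Delta\in\mathscr A$ and the measure $\mu\circ\phi^{-1}$, $\Delta\mapsto\mu(\phi^{-1}(\Delta))$, is absolutely continuous with respect to $\mu$. The composition operator $C_\phi$ in $L^2(\mu)$ is given by $\mathcal D(C_\phi)=\{f\in L^2(\mu)\colon f\circ\phi\in L^2(\mu)\}$, $C_\phi f=f\circ\phi$ (possibly unbounded). A densely defined operator $N$ in a complex Hilbert space is normal if $N$ is closed and $N^*N=NN^*$ (equivalently, $\mathcal D(N)=\mathcal D(N^* )$ and $\|Nf\|=\|N^*f\|$ for all $f\in\mathcal D(N)$). A densely defined operator $A$ is formally normal if $\mathcal D(A)\subseteq\mathcal D(A^* )$ and $\|Af\|=\|A^*f\|$ for all $f\in\mathcal D(A)$. (Both notions include being densely defined.) *)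

theory Defs
  imports "HOL-Analysis.Analysis"
begin

section \<open>Operators in a complex Hilbert space\<close>

text \<open>
  The space of square integrable functions depends on a measure, so it is not a type; Hilbert
  spaces are therefore given by explicit carriers. The inner product is linear in its first
  argument.
\<close>

record 'h hilbert =
  vecs :: "'h set"
  vadd :: "'h \<Rightarrow> 'h \<Rightarrow> 'h"
  vscale :: "complex \<Rightarrow> 'h \<Rightarrow> 'h"
  vinner :: "'h \<Rightarrow> 'h \<Rightarrow> complex"

definition vnorm :: "'h hilbert \<Rightarrow> 'h \<Rightarrow> real" where
  "vnorm H x = sqrt (Re (vinner H x x))"

definition vdist :: "'h hilbert \<Rightarrow> 'h \<Rightarrow> 'h \<Rightarrow> real" where
  "vdist H x y = vnorm H (vadd H x (vscale H (-1) y))"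

text \<open>
  A possibly unbounded operator is a partial function, whose domain is its \<^const>\<open>dom\<close>. Equality
  of operators includes equality of domains, and \<^term>\<open>S \<circ>\<^sub>m T\<close> has the usual domain of a product
  of unbounded operators: the vectors in the domain of \<open>T\<close> that \<open>T\<close> maps into the domain of \<open>S\<close>.
\<close>

definition linear_operator :: "'h hilbert \<Rightarrow> ('h \<rightharpoonup> 'h) \<Rightarrow> bool" where
  "linear_operator H T \<longleftrightarrow>
     dom T \<subseteq> vecs H \<and> ran T \<subseteq> vecs H \<and> dom T \<noteq> {} \<and>
     (\<forall>x\<in>dom T. \<forall>y\<in>dom T. T (vadd H x y) = Some (vadd H (the (T x)) (the (T y)))) \<and>
     (\<forall>c. \<forall>x\<in>dom T. T (vscale H c x) = Some (vscale H c (the (T x))))"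

definition densely_defined :: "'h hilbert \<Rightarrow> ('h \<rightharpoonup> 'h) \<Rightarrow> bool" where
  "densely_defined H T \<longleftrightarrow>
     linear_operator H T \<and> (\<forall>x\<in>vecs H. \<forall>e>0. \<exists>y\<in>dom T. vdist H y x < e)"

definition closed_operator :: "'h hilbert \<Rightarrow> ('h \<rightharpoonup> 'h) \<Rightarrow> bool" where
  "closed_operator H T \<longleftrightarrow>
     (\<forall>u. \<forall>x\<in>vecs H. \<forall>y\<in>vecs H.
        (\<forall>n::nat. u n \<in> dom T) \<and>
        (\<lambda>n. vdist H (u n) x) \<longlonglongrightarrow> 0 \<and>
        (\<lambda>n. vdist H (the (T (u n))) y) \<longlonglongrightarrow> 0 \<longrightarrow>
        T x = Some y)"

text \<open>The vector \<open>k\<close> below is unique when \<open>T\<close> is densely defined.\<close>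

definition adjoint_operator :: "'h hilbert \<Rightarrow> ('h \<rightharpoonup> 'h) \<Rightarrow> ('h \<rightharpoonup> 'h)" where
  "adjoint_operator H T = (\<lambda>g.
     if g \<in> vecs H \<and> (\<exists>k\<in>vecs H. \<forall>f\<in>dom T. vinner H (the (T f)) g = vinner H f k)
     then Some (THE k. k \<in> vecs H \<and> (\<forall>f\<in>dom T. vinner H (the (T f)) g = vinner H f k))
     else None)"

definition normal_operator :: "'h hilbert \<Rightarrow> ('h \<rightharpoonup> 'h) \<Rightarrow> bool" where
  "normal_operator H N \<longleftrightarrow>
     densely_defined H N \<and> closed_operator H N \<and>
     adjoint_operator H N \<circ>\<^sub>m N = N \<circ>\<^sub>m adjoint_operator H N"

definition formally_normal_operator :: "'h hilbert \<Rightarrow> ('h \<rightharpoonup> 'h) \<Rightarrow> bool" where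
  "formally_normal_operator H A \<longleftrightarrow>
     densely_defined H A \<and> dom A \<subseteq> dom (adjoint_operator H A) \<and>
     (\<forall>f\<in>dom A. vnorm H (the (A f)) = vnorm H (the (adjoint_operator H A f)))"

section \<open>The space of square integrable functions\<close>

definition square_integrable :: "'a measure \<Rightarrow> ('a \<Rightarrow> complex) set" where
  "square_integrable M =
     {f \<in> borel_measurable M. integrable M (\<lambda>x. (cmod (f x))\<^sup>2)}"

definition ae_equal :: "'a measure \<Rightarrow> (('a \<Rightarrow> complex) \<times> ('a \<Rightarrow> complex)) set" where
  "ae_equal M =
     {(f, g). f \<in> square_integrable M \<and> g \<in> square_integrable M \<and> (AE x in M. f x = g x)}"

definition ae_class :: "'a measure \<Rightarrow> ('a \<Rightarrow> complex) \<Rightarrow> ('a \<Rightarrow> complex) set" where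
  "ae_class M f = ae_equal M `` {f}"

definition ae_rep :: "('a \<Rightarrow> complex) set \<Rightarrow> ('a \<Rightarrow> complex)" where
  "ae_rep F = (SOME f. f \<in> F)"

definition L2_space :: "'a measure \<Rightarrow> ('a \<Rightarrow> complex) set hilbert" where
  "L2_space M =
     \<lparr>vecs = square_integrable M // ae_equal M,
      vadd = (\<lambda>F G. ae_class M (\<lambda>x. ae_rep F x + ae_rep G x)),
      vscale = (\<lambda>c F. ae_class M (\<lambda>x. c * ae_rep F x)),
      vinner = (\<lambda>F G. LINT x|M. ae_rep F x * cnj (ae_rep G x))\<rparr>"

section \<open>Composition operators\<close>

definition nonsingular_transformation :: "'a measure \<Rightarrow> ('a \<Rightarrow> 'a) \<Rightarrow> bool" where
  "nonsingular_transformation M \<phi> \<longleftrightarrow>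
     \<phi> \<in> M \<rightarrow>\<^sub>M M \<and> absolutely_continuous M (distr M M \<phi>)"

text \<open>For nonsingular \<open>\<phi>\<close> neither the domain nor the value depends on the representative.\<close>

definition composition_operator ::
    "'a measure \<Rightarrow> ('a \<Rightarrow> 'a) \<Rightarrow> (('a \<Rightarrow> complex) set \<rightharpoonup> ('a \<Rightarrow> complex) set)" where
  "composition_operator M \<phi> = (\<lambda>F.
     if F \<in> vecs (L2_space M) \<and> ae_rep F \<circ> \<phi> \<in> square_integrable M
     then Some (ae_class M (ae_rep F \<circ> \<phi>)) else None)"

section \<open>Independence of representatives\<close>

lemma equiv_ae_equal: "equiv (square_integrable M) (ae_equal M)"
proof (rule equivI)
  show "ae_equal M \<subseteq> square_integrable M \<times> square_integrable M"
    by (auto simp: ae_equal_def)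
  show "refl_on (square_integrable M) (ae_equal M)"
    by (auto simp: refl_on_def ae_equal_def)
  show "sym (ae_equal M)"
    by (auto simp: sym_def ae_equal_def elim: AE_mp)
  show "trans (ae_equal M)"
    unfolding trans_def ae_equal_def by (auto elim: AE_mp)
qed

lemma ae_class_in_L2:
  "f \<in> square_integrable M \<Longrightarrow> ae_class M f \<in> vecs (L2_space M)"
  by (auto simp: L2_space_def ae_class_def intro: quotientI)

lemma ae_rep_ae_class:
  assumes "f \<in> square_integrable M"
  shows "(f, ae_rep (ae_class M f)) \<in> ae_equal M"
proof -
  have "f \<in> ae_class M f"
    unfolding ae_class_def using equiv_class_self[OF equiv_ae_equal assms] .
  then have "ae_rep (ae_class M f) \<in> ae_class M f"
    unfolding ae_rep_def by (auto simp: some_in_eq)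
  then show ?thesis by (simp add: ae_class_def)
qed

lemma ae_class_eq_iff:
  assumes "f \<in> square_integrable M" "g \<in> square_integrable M"
  shows "ae_class M f = ae_class M g \<longleftrightarrow> (AE x in M. f x = g x)"
  using eq_equiv_class_iff[OF equiv_ae_equal assms] assms
  by (simp add: ae_class_def ae_equal_def)

lemma ae_class_ae_rep:
  assumes "F \<in> vecs (L2_space M)"
  shows "ae_rep F \<in> square_integrable M" "ae_class M (ae_rep F) = F"
proof -
  obtain f where f: "f \<in> square_integrable M" "F = ae_class M f"
    using assms by (auto simp: L2_space_def ae_class_def elim: quotientE)
  have r: "(f, ae_rep F) \<in> ae_equal M" using ae_rep_ae_class[OF f(1)] f(2) by simp
  then show r': "ae_rep F \<in> square_integrable M" by (simp add: ae_equal_def)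
  show "ae_class M (ae_rep F) = F"
    using r ae_class_eq_iff[OF f(1) r'] f(2) by (simp add: ae_equal_def)
qed

lemma vinner_ae_class:
  assumes "f \<in> square_integrable M" "g \<in> square_integrable M"
  shows "vinner (L2_space M) (ae_class M f) (ae_class M g) = (LINT x|M. f x * cnj (g x))"
proof -
  let ?f = "ae_rep (ae_class M f)" and ?g = "ae_rep (ae_class M g)"
  have f: "(f, ?f) \<in> ae_equal M" and g: "(g, ?g) \<in> ae_equal M"
    using assms ae_rep_ae_class by auto
  have [measurable]: "f \<in> borel_measurable M" "?f \<in> borel_measurable M"
    "g \<in> borel_measurable M" "?g \<in> borel_measurable M"
    using f g by (auto simp: ae_equal_def square_integrable_def)
  have cnj_meas [measurable]: "cnj \<in> borel_measurable borel"
    by (intro borel_measurable_continuous_onI continuous_intros)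
  have "AE x in M. f x = ?f x" "AE x in M. g x = ?g x"
    using f g by (auto simp: ae_equal_def)
  then have "AE x in M. ?f x * cnj (?g x) = f x * cnj (g x)"
    by eventually_elim simp
  then have "(LINT x|M. ?f x * cnj (?g x)) = (LINT x|M. f x * cnj (g x))"
    by (intro integral_cong_AE) measurable
  then show ?thesis by (simp add: L2_space_def)
qed

lemma AE_nonsingular:
  assumes "nonsingular_transformation M \<phi>" "AE x in M. P x"
  shows "AE x in M. P (\<phi> x)"
proof -
  have \<phi>: "\<phi> \<in> M \<rightarrow>\<^sub>M M" and ac: "absolutely_continuous M (distr M M \<phi>)"
    using assms(1) by (auto simp: nonsingular_transformation_def)
  have "AE x in distr M M \<phi>. P x"
    using absolutely_continuous_AE[OF _ ac assms(2)] by simp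
  then show ?thesis by (rule AE_distrD[OF \<phi>])
qed

lemma composition_operator_ae_class:
  assumes \<phi>: "nonsingular_transformation M \<phi>" and f: "f \<in> square_integrable M"
  shows "composition_operator M \<phi> (ae_class M f) =
    (if f \<circ> \<phi> \<in> square_integrable M then Some (ae_class M (f \<circ> \<phi>)) else None)"
proof -
  let ?r = "ae_rep (ae_class M f)"
  have r: "?r \<in> square_integrable M" and ae: "AE x in M. f x = ?r x"
    using ae_rep_ae_class[OF f] by (auto simp: ae_equal_def)
  have ae': "AE x in M. (f \<circ> \<phi>) x = (?r \<circ> \<phi>) x"
    using AE_nonsingular[OF \<phi> ae] by simp
  have [measurable]: "\<phi> \<in> M \<rightarrow>\<^sub>M M" "f \<in> borel_measurable M" "?r \<in> borel_measurable M"
    using \<phi> f r by (auto simp: nonsingular_transformation_def square_integrable_def)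
  have m [measurable]: "f \<circ> \<phi> \<in> borel_measurable M" "?r \<circ> \<phi> \<in> borel_measurable M"
    by measurable
  have "AE x in M. (cmod ((f \<circ> \<phi>) x))\<^sup>2 = (cmod ((?r \<circ> \<phi>) x))\<^sup>2"
    using ae' by eventually_elim simp
  then have "integrable M (\<lambda>x. (cmod ((f \<circ> \<phi>) x))\<^sup>2) \<longleftrightarrow>
      integrable M (\<lambda>x. (cmod ((?r \<circ> \<phi>) x))\<^sup>2)"
    by (intro integrable_cong_AE) measurable
  then have iff: "f \<circ> \<phi> \<in> square_integrable M \<longleftrightarrow> ?r \<circ> \<phi> \<in> square_integrable M"
    using m by (simp add: square_integrable_def)
  have "ae_class M (?r \<circ> \<phi>) = ae_class M (f \<circ> \<phi>)" if "f \<circ> \<phi> \<in> square_integrable M"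
    using that iff ae' ae_class_eq_iff by metis
  then show ?thesis
    using iff ae_class_in_L2[OF f] by (simp add: composition_operator_def)
qed

end

theory Submission
  imports Defs
begin

text \<open>
  Let \<open>h\<close> be the Radon--Nikodym derivative of \<open>\<mu> \<circ> \<phi>\<^sup>-\<^sup>1\<close>, finite almost everywhere when \<open>C\<close> is
  densely defined. Either notion of normality gives \<open>\<parallel>C1\<^sub>A\<parallel> = \<parallel>C\<^sup>*1\<^sub>A\<parallel>\<close> for all sets \<open>A\<close> of finite
  measure on which \<open>h\<close> is bounded. For disjoint \<open>A\<close>, \<open>B\<close> the vectors \<open>C1\<^sub>A\<close>, \<open>C1\<^sub>B\<close> are orthogonal,
  hence so are the nonnegative functions \<open>C\<^sup>*1\<^sub>A\<close>, \<open>C\<^sup>*1\<^sub>B\<close>, which therefore have disjoint supports.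
  This makes \<open>A\<close> the preimage under \<open>\<phi>\<close> of the support \<open>D\<close> of \<open>C\<^sup>*1\<^sub>A\<close>, up to a null set. Then
  \<open>C\<^sup>*1\<^sub>A = h1\<^sub>D\<close>, and comparing norms once more gives \<open>h \<circ> \<phi> = h\<close> almost everywhere. Conversely,
  if every measurable set is a preimage modulo null sets and \<open>h \<circ> \<phi> = h\<close>, then every \<open>g\<close> in \<open>L\<^sup>2\<close> has
  the form \<open>v \<circ> \<phi>\<close>, \<open>C\<^sup>*g = hv\<close>, and \<open>C\<^sup>*C\<close> and \<open>CC\<^sup>*\<close> are both multiplication by \<open>h\<close>.
\<close>

section \<open>Square integrable functions and their classes\<close>

lemma square_integrable_iff_nn:
  "f \<in> square_integrable M \<longleftrightarrow>
    f \<in> borel_measurable M \<and> (\<integral>\<^sup>+x. ennreal ((cmod (f x))\<^sup>2) \<partial>M) < \<infinity>"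
  by (auto simp: square_integrable_def integrable_iff_bounded)

lemma square_integrable_bounded_by:
  assumes "g \<in> square_integrable M" "f \<in> borel_measurable M"
    "AE x in M. (cmod (f x))\<^sup>2 \<le> c * (cmod (g x))\<^sup>2"
  shows "f \<in> square_integrable M"
proof -
  have "integrable M (\<lambda>x. c * (cmod (g x))\<^sup>2)"
    using assms(1) by (auto simp: square_integrable_def)
  then have "integrable M (\<lambda>x. (cmod (f x))\<^sup>2)"
    by (rule Bochner_Integration.integrable_bound) (use assms(2,3) in auto)
  then show ?thesis using assms(2) by (simp add: square_integrable_def)
qed

lemma square_integrable_cong_AE:
  assumes "f \<in> square_integrable M" "g \<in> borel_measurable M" "AE x in M. f x = g x"
  shows "g \<in> square_integrable M"
  by (rule square_integrable_bounded_by[OF assms(1,2), of 1]) (use assms(3) in auto)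

lemma square_integrable_add:
  assumes "f \<in> square_integrable M" "g \<in> square_integrable M"
  shows "(\<lambda>x. f x + g x) \<in> square_integrable M"
proof -
  have [measurable]: "f \<in> borel_measurable M" "g \<in> borel_measurable M"
    using assms by (auto simp: square_integrable_def)
  have "integrable M (\<lambda>x. 2 * (cmod (f x))\<^sup>2 + 2 * (cmod (g x))\<^sup>2)"
    using assms by (auto simp: square_integrable_def)
  moreover have "(cmod (f x + g x))\<^sup>2 \<le> 2 * (cmod (f x))\<^sup>2 + 2 * (cmod (g x))\<^sup>2" for x
  proof -
    have "(cmod (f x + g x))\<^sup>2 \<le> (cmod (f x) + cmod (g x))\<^sup>2"
      by (intro power_mono norm_triangle_ineq) auto
    also have "\<dots> \<le> 2 * (cmod (f x))\<^sup>2 + 2 * (cmod (g x))\<^sup>2"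
      using sum_squares_bound[of "cmod (f x)" "cmod (g x)"] by (simp add: power2_sum)
    finally show ?thesis .
  qed
  ultimately have "integrable M (\<lambda>x. (cmod (f x + g x))\<^sup>2)"
    by (elim Bochner_Integration.integrable_bound) auto
  then show ?thesis by (simp add: square_integrable_def)
qed

lemma square_integrable_scale:
  "f \<in> square_integrable M \<Longrightarrow> (\<lambda>x. c * f x) \<in> square_integrable M"
  by (rule square_integrable_bounded_by[where g = f and c = "(cmod c)\<^sup>2"])
    (auto simp: norm_mult power_mult_distrib square_integrable_def)

lemma square_integrable_diff:
  assumes "f \<in> square_integrable M" "g \<in> square_integrable M"
  shows "(\<lambda>x. f x - g x) \<in> square_integrable M"
  using square_integrable_add[OF assms(1) square_integrable_scale[OF assms(2), of "-1"]] by simp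

lemma indicator_square_integrable:
  assumes "A \<in> sets M" "emeasure M A < \<infinity>"
  shows "indicator A \<in> square_integrable M"
proof -
  have "(\<integral>\<^sup>+x. ennreal ((cmod (indicator A x :: complex))\<^sup>2) \<partial>M) = (\<integral>\<^sup>+x. indicator A x \<partial>M)"
    by (intro nn_integral_cong) (auto split: split_indicator)
  then show ?thesis using assms by (simp add: square_integrable_iff_nn)
qed

lemma borel_measurable_cnj [measurable]: "cnj \<in> borel_measurable borel"
  by (intro borel_measurable_continuous_onI continuous_intros)

lemma integrable_mult_cnj:
  assumes "f \<in> square_integrable M" "g \<in> square_integrable M"
  shows "integrable M (\<lambda>x. f x * cnj (g x))"
proof (rule Bochner_Integration.integrable_bound)
  have [measurable]: "f \<in> borel_measurable M" "g \<in> borel_measurable M"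
    using assms by (auto simp: square_integrable_def)
  show "integrable M (\<lambda>x. (cmod (f x))\<^sup>2 + (cmod (g x))\<^sup>2)"
    using assms by (auto simp: square_integrable_def)
  show "(\<lambda>x. f x * cnj (g x)) \<in> borel_measurable M" by measurable
  have "cmod (f x) * cmod (g x) \<le> (cmod (f x))\<^sup>2 + (cmod (g x))\<^sup>2" for x
    using sum_squares_bound[of "cmod (f x)" "cmod (g x)"]
      mult_nonneg_nonneg[OF norm_ge_zero norm_ge_zero, of "f x" "g x"]
    unfolding mult.assoc by linarith
  then show "AE x in M. cmod (f x * cnj (g x)) \<le> norm ((cmod (f x))\<^sup>2 + (cmod (g x))\<^sup>2)"
    by (auto simp: norm_mult)
qed

lemma vnorm_ae_class:
  assumes "f \<in> square_integrable M"
  shows "vnorm (L2_space M) (ae_class M f) = sqrt (LINT x|M. (cmod (f x))\<^sup>2)"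
proof -
  have "(LINT x|M. f x * cnj (f x)) = (LINT x|M. complex_of_real ((cmod (f x))\<^sup>2))"
    by (simp only: complex_norm_square)
  then show ?thesis
    unfolding vnorm_def vinner_ae_class[OF assms assms] by (simp del: of_real_power)
qed

lemma vdist_ae_class:
  assumes f: "f \<in> square_integrable M" and g: "g \<in> square_integrable M"
  shows "vdist (L2_space M) (ae_class M f) (ae_class M g) = sqrt (LINT x|M. (cmod (f x - g x))\<^sup>2)"
proof -
  let ?r = ae_rep and ?c = "ae_class M"
  \<comment> \<open>Each operation on classes chooses its own representative, so the multiple by
    \<open>-1\<close> is again replaced by a representative of its class before it is added; three
    almost everywhere equalities undo these choices.\<close>
  define s where "s = (\<lambda>x. - 1 * ?r (?c g) x)"
  have rf: "?r (?c f) \<in> square_integrable M" "AE x in M. f x = ?r (?c f) x"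
    using ae_rep_ae_class[OF f] by (auto simp: ae_equal_def)
  have rg: "?r (?c g) \<in> square_integrable M" "AE x in M. g x = ?r (?c g) x"
    using ae_rep_ae_class[OF g] by (auto simp: ae_equal_def)
  have s: "s \<in> square_integrable M" unfolding s_def by (rule square_integrable_scale[OF rg(1)])
  have rs: "?r (?c s) \<in> square_integrable M" "AE x in M. s x = ?r (?c s) x"
    using ae_rep_ae_class[OF s] by (auto simp: ae_equal_def)
  have "AE x in M. ?r (?c f) x + ?r (?c s) x = f x - g x"
    using rf(2) rg(2) rs(2) by eventually_elim (auto simp: s_def)
  then have "?c (\<lambda>x. ?r (?c f) x + ?r (?c s) x) = ?c (\<lambda>x. f x - g x)"
    using square_integrable_add[OF rf(1) rs(1)] square_integrable_diff[OF f g]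
    by (simp add: ae_class_eq_iff)
  then have "vdist (L2_space M) (?c f) (?c g) = vnorm (L2_space M) (?c (\<lambda>x. f x - g x))"
    unfolding vdist_def by (simp add: L2_space_def s_def)
  then show ?thesis using vnorm_ae_class[OF square_integrable_diff[OF f g]] by simp
qed

lemma L2_space_cases:
  assumes "F \<in> vecs (L2_space M)"
  obtains f where "f \<in> square_integrable M" "F = ae_class M f"
  using ae_class_ae_rep[OF assms] by metis

section \<open>Composition on classes and closedness\<close>

text \<open>Almost everywhere equality with \<open>g\<close> already makes
  \<open>f \<circ> \<phi>\<close> square integrable, so membership in the domain follows from the
  right side.\<close>

lemma composition_operator_eq_Some_iff:
  assumes \<phi>: "nonsingular_transformation M \<phi>"
    and f: "f \<in> square_integrable M" and g: "g \<in> square_integrable M"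
  shows "composition_operator M \<phi> (ae_class M f) = Some (ae_class M g) \<longleftrightarrow>
    (AE x in M. f (\<phi> x) = g x)"
proof -
  have m: "f \<circ> \<phi> \<in> borel_measurable M"
    using \<phi> f by (auto simp: nonsingular_transformation_def square_integrable_def)
  have "f \<circ> \<phi> \<in> square_integrable M" if "AE x in M. f (\<phi> x) = g x"
    by (rule square_integrable_cong_AE[OF g m]) (use that in auto)
  then show ?thesis
    using ae_class_eq_iff[OF _ g, of "f \<circ> \<phi>"] by (auto simp: composition_operator_ae_class[OF \<phi> f])
qed

lemma composition_operator_domE:
  assumes \<phi>: "nonsingular_transformation M \<phi>" and "F \<in> dom (composition_operator M \<phi>)"
  obtains f where "f \<in> square_integrable M" "f \<circ> \<phi> \<in> square_integrable M" "F = ae_class M f"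
    "composition_operator M \<phi> F = Some (ae_class M (f \<circ> \<phi>))"
proof -
  have "F \<in> vecs (L2_space M)" using assms(2) by (auto simp: composition_operator_def split: if_splits)
  then obtain f where f: "f \<in> square_integrable M" "F = ae_class M f" by (rule L2_space_cases)
  moreover have "f \<circ> \<phi> \<in> square_integrable M"
    using assms(2) f by (auto simp: composition_operator_ae_class[OF \<phi>] dom_def split: if_splits)
  ultimately show ?thesis using that[of f] by (simp add: composition_operator_ae_class[OF \<phi>])
qed

lemma ae_class_domI:
  assumes "nonsingular_transformation M \<phi>"
    "f \<in> square_integrable M" "f \<circ> \<phi> \<in> square_integrable M"
  shows "ae_class M f \<in> dom (composition_operator M \<phi>)"
  using assms by (auto simp: composition_operator_ae_class)

text \<open>The squared distance is the \<open>L1\<close> norm of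
  \<open>(cmod (u n x - f x))\<^sup>2\<close>. Convergence to zero in \<open>L1\<close> holds almost
  everywhere along a subsequence, and square roots lead back to \<open>u\<close>.\<close>

lemma L2_convergence_AE_subseq:
  assumes u: "\<And>n. u n \<in> square_integrable M" and f: "f \<in> square_integrable M"
    and lim: "(\<lambda>n. vdist (L2_space M) (ae_class M (u n)) (ae_class M f)) \<longlonglongrightarrow> 0"
  obtains r where "strict_mono r" "AE x in M. (\<lambda>n. u (r n) x) \<longlonglongrightarrow> f x"
proof -
  let ?d = "\<lambda>n x. (cmod (u n x - f x))\<^sup>2"
  have i: "integrable M (?d n)" for n
    using square_integrable_diff[OF u f] by (simp add: square_integrable_def)
  have "(\<lambda>n. (sqrt (LINT x|M. ?d n x))\<^sup>2) \<longlonglongrightarrow> 0\<^sup>2"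
    using lim by (intro tendsto_power) (simp add: vdist_ae_class[OF u f])
  then have "(\<lambda>n. LINT x|M. norm (?d n x)) \<longlonglongrightarrow> 0" by simp
  then obtain r where r: "strict_mono r" "AE x in M. (\<lambda>n. ?d (r n) x) \<longlonglongrightarrow> 0"
    using tendsto_L1_AE_subseq[of M ?d] i by blast
  have "(\<lambda>n. u (r n) x) \<longlonglongrightarrow> f x" if "(\<lambda>n. ?d (r n) x) \<longlonglongrightarrow> 0" for x
  proof -
    have "(\<lambda>n. sqrt (?d (r n) x)) \<longlonglongrightarrow> sqrt 0" using that by (rule tendsto_real_sqrt)
    then have "(\<lambda>n. u (r n) x - f x) \<longlonglongrightarrow> 0" by (simp add: tendsto_norm_zero_iff)
    then show ?thesis by (simp add: LIM_zero_iff)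
  qed
  then show ?thesis using r that by (metis (mono_tags, lifting) AE_mp AE_I2)
qed

text \<open>Norm limits are read off along almost everywhere convergent subsequences. Nonsingularity
  lets the first limit be evaluated at \<open>\<phi> x\<close>, where it must agree with the second
  one.\<close>

lemma closed_composition_operator:
  assumes \<phi>: "nonsingular_transformation M \<phi>"
  shows "closed_operator (L2_space M) (composition_operator M \<phi>)"
  unfolding closed_operator_def
proof (intro allI ballI impI, elim conjE)
  let ?C = "composition_operator M \<phi>" and ?d = "vdist (L2_space M)"
  fix U F G
  assume F: "F \<in> vecs (L2_space M)" and G: "G \<in> vecs (L2_space M)"
    and U: "\<forall>n::nat. U n \<in> dom ?C" and UF: "(\<lambda>n. ?d (U n) F) \<longlonglongrightarrow> 0"
    and UG: "(\<lambda>n. ?d (the (?C (U n))) G) \<longlonglongrightarrow> 0"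
  obtain f g where f: "f \<in> square_integrable M" "F = ae_class M f"
    and g: "g \<in> square_integrable M" "G = ae_class M g"
    using F G by (metis L2_space_cases)
  have "\<forall>n. \<exists>u. u \<in> square_integrable M \<and> u \<circ> \<phi> \<in> square_integrable M \<and> U n = ae_class M u \<and>
      ?C (U n) = Some (ae_class M (u \<circ> \<phi>))"
    using U composition_operator_domE[OF \<phi>] by metis
  then obtain u where u: "\<And>n. u n \<in> square_integrable M" "\<And>n. u n \<circ> \<phi> \<in> square_integrable M"
    "\<And>n. U n = ae_class M (u n)" "\<And>n. ?C (U n) = Some (ae_class M (u n \<circ> \<phi>))"
    by metis
  have "(\<lambda>n. ?d (ae_class M (u n)) (ae_class M f)) \<longlonglongrightarrow> 0"
    using UF unfolding f(2) u(3) .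
  then obtain r where r: "strict_mono r" "AE x in M. (\<lambda>n. u (r n) x) \<longlonglongrightarrow> f x"
    by (rule L2_convergence_AE_subseq[OF u(1) f(1)])
  have "(\<lambda>n. ?d (ae_class M (u n \<circ> \<phi>)) (ae_class M g)) \<longlonglongrightarrow> 0"
    using UG unfolding u(4) g(2) by simp
  \<comment> \<open>The second extraction is made inside the first, so that both limits hold along
    \<open>r (s n)\<close>.\<close>
  then have "(\<lambda>n. ?d (ae_class M (u (r n) \<circ> \<phi>)) (ae_class M g)) \<longlonglongrightarrow> 0"
    using LIMSEQ_subseq_LIMSEQ[OF _ r(1)] by (fastforce simp: o_def)
  then obtain s where s: "strict_mono s" "AE x in M. (\<lambda>n. (u (r (s n)) \<circ> \<phi>) x) \<longlonglongrightarrow> g x"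
    using L2_convergence_AE_subseq[where u = "\<lambda>n. u (r n) \<circ> \<phi>", OF u(2) g(1)] by blast
  have "AE x in M. (\<lambda>n. u (r n) (\<phi> x)) \<longlonglongrightarrow> f (\<phi> x)"
    by (rule AE_nonsingular[OF \<phi> r(2)])
  with s(2) have "AE x in M. f (\<phi> x) = g x"
  proof eventually_elim
    case (elim x)
    have "(\<lambda>n. u (r (s n)) (\<phi> x)) \<longlonglongrightarrow> f (\<phi> x)"
      using LIMSEQ_subseq_LIMSEQ[OF elim(2) s(1)] by (simp add: o_def)
    then show ?case using elim(1) LIMSEQ_unique by auto
  qed
  then show "?C F = Some G"
    using composition_operator_eq_Some_iff[OF \<phi> f(1) g(1)] f(2) g(2) by simp
qed

section \<open>Change of variables and sets on which the density is bounded\<close>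

text \<open>A real-valued density \<open>h\<close> exists precisely when the composition operator is densely defined.\<close>

locale composition_density = sigma_finite_measure M for M :: "'a measure" +
  fixes \<phi> :: "'a \<Rightarrow> 'a" and h :: "'a \<Rightarrow> real"
  assumes nonsingular: "nonsingular_transformation M \<phi>"
    and h_measurable [measurable]: "h \<in> borel_measurable M"
    and h_nonneg: "0 \<le> h x"
    and distr_eq_density: "distr M M \<phi> = density M (\<lambda>x. ennreal (h x))"
begin

abbreviation "L \<equiv> square_integrable M"

lemma phi_measurable [measurable]: "\<phi> \<in> M \<rightarrow>\<^sub>M M"
  using nonsingular by (simp add: nonsingular_transformation_def)

lemma L_measurable: "f \<in> L \<Longrightarrow> f \<in> borel_measurable M"
  by (simp add: square_integrable_def)

lemma nn_integral_comp:
  assumes [measurable]: "w \<in> borel_measurable M"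
  shows "(\<integral>\<^sup>+x. w (\<phi> x) \<partial>M) = (\<integral>\<^sup>+x. ennreal (h x) * w x \<partial>M)"
proof -
  have "(\<integral>\<^sup>+x. w (\<phi> x) \<partial>M) = (\<integral>\<^sup>+x. w x \<partial>distr M M \<phi>)"
    by (simp add: nn_integral_distr)
  also have "\<dots> = (\<integral>\<^sup>+x. ennreal (h x) * w x \<partial>M)"
    unfolding distr_eq_density by (simp add: nn_integral_density)
  finally show ?thesis .
qed

lemma integral_comp:
  fixes w :: "'a \<Rightarrow> 'b :: {banach, second_countable_topology}"
  assumes [measurable]: "w \<in> borel_measurable M"
  shows "(LINT x|M. w (\<phi> x)) = (LINT x|M. h x *\<^sub>R w x)"
proof -
  have "(LINT x|M. w (\<phi> x)) = (LINT x|distr M M \<phi>. w x)"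
    by (simp add: integral_distr)
  also have "\<dots> = (LINT x|M. h x *\<^sub>R w x)"
    unfolding distr_eq_density by (simp add: integral_density h_nonneg)
  finally show ?thesis .
qed

lemma comp_square_integrable_iff:
  assumes [measurable]: "f \<in> borel_measurable M"
  shows "f \<circ> \<phi> \<in> L \<longleftrightarrow> (\<integral>\<^sup>+x. ennreal (h x) * ennreal ((cmod (f x))\<^sup>2) \<partial>M) < \<infinity>"
  using nn_integral_comp[of "\<lambda>x. ennreal ((cmod (f x))\<^sup>2)"]
  by (simp add: square_integrable_iff_nn o_def)

lemma cnj_indicator [simp]: "cnj (indicator A x) = indicator A x"
  by (auto split: split_indicator)

text \<open>The sets that carry the test functions: finite measure puts the indicator into
  \<open>L\<close>, and a bound on \<open>h\<close> keeps its composition with \<open>\<phi>\<close>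
  in \<open>L\<close>.\<close>

definition bounded_set :: "'a set \<Rightarrow> bool" where
  "bounded_set A \<longleftrightarrow> A \<in> sets M \<and> emeasure M A < \<infinity> \<and> (\<exists>c. \<forall>x\<in>A. h x \<le> c)"

lemma bounded_set_subset:
  assumes "bounded_set A" "B \<in> sets M" "B \<subseteq> A"
  shows "bounded_set B"
  using assms emeasure_mono[of B A M] by (fastforce simp: bounded_set_def)

lemma bounded_set_Un:
  assumes "bounded_set A" "bounded_set B"
  shows "bounded_set (A \<union> B)"
proof -
  obtain c d where "\<forall>x\<in>A. h x \<le> c" "\<forall>x\<in>B. h x \<le> d"
    using assms by (auto simp: bounded_set_def)
  then have "\<forall>x\<in>A \<union> B. h x \<le> max c d" by (auto simp: le_max_iff_disj)
  moreover have "emeasure M (A \<union> B) \<le> emeasure M A + emeasure M B"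
    using assms by (intro emeasure_subadditive) (auto simp: bounded_set_def)
  ultimately show ?thesis using assms
    by (auto simp: bounded_set_def intro: le_less_trans)
qed

lemma bounded_exhaustion:
  obtains E :: "nat \<Rightarrow> 'a set"
  where "\<And>n. bounded_set (E n)" "incseq E" "(\<Union>n. E n) = space M"
proof -
  obtain F :: "nat \<Rightarrow> 'a set"
    where F: "range F \<subseteq> sets M" "(\<Union>i. F i) = space M" "\<And>i. emeasure M (F i) \<noteq> \<infinity>" "incseq F"
    using sigma_finite_incseq by blast
  have [measurable]: "F n \<in> sets M" for n using F(1) by auto
  \<comment> \<open>Sigma-finiteness supplies the sets of finite measure; the level sets exhaust the
    space because \<open>h\<close> is real-valued.\<close>
  define E where "E n = F n \<inter> {x \<in> space M. h x \<le> real n}" for n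
  have m: "E n \<in> sets M" for n unfolding E_def by measurable
  show ?thesis
  proof
    show "bounded_set (E n)" for n
      using m[of n] emeasure_mono[of "E n" "F n" M] F(3)[of n]
      by (auto simp: bounded_set_def E_def top.not_eq_extremum intro: le_less_trans)
    show "incseq E"
      using F(4) unfolding E_def incseq_def by fastforce
    show "(\<Union>n. E n) = space M"
    proof
      show "space M \<subseteq> (\<Union>n. E n)"
      proof
        fix x assume x: "x \<in> space M"
        then obtain i where i: "x \<in> F i" using F(2) by blast
        obtain j :: nat where j: "h x \<le> real j" using real_arch_simple by blast
        have "x \<in> F (max i j)" using F(4) i by (meson incseqD max.cobounded1 subsetD)
        then have "x \<in> E (max i j)" using x j by (auto simp: E_def)
        then show "x \<in> (\<Union>n. E n)" by blast
      qed
    qed (auto simp: E_def)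
  qed
qed

lemma AE_by_bounded_sets:
  assumes "\<And>A. bounded_set A \<Longrightarrow> AE x in M. x \<in> A \<longrightarrow> P x"
  shows "AE x in M. P x"
proof -
  obtain E :: "nat \<Rightarrow> 'a set" where E: "\<And>n. bounded_set (E n)" "(\<Union>n. E n) = space M"
    using bounded_exhaustion by metis
  have "AE x in M. \<forall>n. x \<in> E n \<longrightarrow> P x"
    unfolding AE_all_countable using assms E(1) by blast
  then show ?thesis
    using AE_space by eventually_elim (use E(2) in auto)
qed

text \<open>Since \<open>\<phi>\<close> maps the space into itself, the preimages of an exhaustion
  cover the space as well. This form suits statements about \<open>\<phi> x\<close>.\<close>

lemma AE_by_bounded_preimages:
  assumes "\<And>A. bounded_set A \<Longrightarrow> AE x in M. \<phi> x \<in> A \<longrightarrow> P x"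
  shows "AE x in M. P x"
proof -
  obtain E :: "nat \<Rightarrow> 'a set" where E: "\<And>n. bounded_set (E n)" "(\<Union>n. E n) = space M"
    using bounded_exhaustion by metis
  have "AE x in M. \<forall>n. \<phi> x \<in> E n \<longrightarrow> P x"
    unfolding AE_all_countable using assms E(1) by blast
  then show ?thesis
    using AE_space
  proof eventually_elim
    case (elim x)
    then have "\<phi> x \<in> space M" using measurable_space[OF phi_measurable] by blast
    then show ?case using elim(1) E(2) by blast
  qed
qed

text \<open>Change of variables puts the weight \<open>h\<close> in front of the squared modulus,
  and on \<open>A\<close> this weight is at most a constant.\<close>

lemma cut_square_integrable:
  assumes A: "bounded_set A" and u: "u \<in> L"
  shows "(\<lambda>x. indicator A x * u x) \<in> L" "(\<lambda>x. indicator A x * u x) \<circ> \<phi> \<in> L"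
proof -
  have [measurable]: "A \<in> sets M" "u \<in> borel_measurable M"
    using A u by (auto simp: bounded_set_def L_measurable)
  obtain c where c: "\<And>x. x \<in> A \<Longrightarrow> h x \<le> c" using A by (auto simp: bounded_set_def)
  show "(\<lambda>x. indicator A x * u x) \<in> L"
    by (rule square_integrable_bounded_by[OF u, of _ 1]) (auto split: split_indicator)
  have "(\<integral>\<^sup>+x. ennreal (h x) * ennreal ((cmod (indicator A x * u x))\<^sup>2) \<partial>M)
      \<le> (\<integral>\<^sup>+x. ennreal c * ennreal ((cmod (u x))\<^sup>2) \<partial>M)"
    by (intro nn_integral_mono) (auto split: split_indicator intro!: mult_right_mono ennreal_leI c)
  also have "\<dots> < \<infinity>"
    using u by (simp add: nn_integral_cmult square_integrable_iff_nn ennreal_mult_less_top)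
  finally show "(\<lambda>x. indicator A x * u x) \<circ> \<phi> \<in> L"
    by (subst comp_square_integrable_iff) auto
qed

lemma bounded_indicator:
  assumes "bounded_set A"
  shows "indicator A \<in> L" "indicator A \<circ> \<phi> \<in> L"
proof -
  show i: "indicator A \<in> L"
    using assms by (simp add: bounded_set_def indicator_square_integrable)
  have "(\<lambda>x. indicator A x * indicator A x :: complex) = indicator A"
    by (auto split: split_indicator)
  then show "indicator A \<circ> \<phi> \<in> L"
    using cut_square_integrable(2)[OF assms i] by simp
qed

section \<open>Values of the adjoint, for functions and for classes\<close>

text \<open>For densely defined operators this says that the adjoint maps the class of \<open>f\<close> to that of
  \<open>k\<close>.\<close>

definition adjoint_value :: "('a \<Rightarrow> complex) \<Rightarrow> ('a \<Rightarrow> complex) \<Rightarrow> bool" where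
  "adjoint_value f k \<longleftrightarrow> f \<in> L \<and> k \<in> L \<and>
     (\<forall>u\<in>L. u \<circ> \<phi> \<in> L \<longrightarrow>
       (LINT x|M. u (\<phi> x) * cnj (f x)) = (LINT x|M. u x * cnj (k x)))"

text \<open>Cutting off to a bounded set turns every function of \<open>L\<close> into a member of
  the domain, so the adjoint identity can be tested against an arbitrary \<open>u\<close> in
  \<open>L\<close>.\<close>

lemma adjoint_value_cut:
  assumes "adjoint_value f k" "bounded_set A" "u \<in> L"
  shows "(LINT x|M. indicator A (\<phi> x) * u (\<phi> x) * cnj (f x)) =
    (LINT x|M. indicator A x * u x * cnj (k x))"
  using assms(1) cut_square_integrable[OF assms(2,3)]
  unfolding adjoint_value_def by (elim conjE) (drule bspec, assumption, simp)

text \<open>The test function is the difference of \<open>a\<close> and \<open>b\<close>, cut off to a set of the exhaustion.\<close>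

lemma cut_test_unique:
  assumes [measurable]: "a \<in> borel_measurable M" "b \<in> borel_measurable M"
    and aL: "\<And>A. bounded_set A \<Longrightarrow> (\<lambda>x. indicator A x * a x) \<in> L"
    and bL: "\<And>A. bounded_set A \<Longrightarrow> (\<lambda>x. indicator A x * b x) \<in> L"
    and eq: "\<And>A u. bounded_set A \<Longrightarrow> u \<in> L \<Longrightarrow>
      (LINT x|M. indicator A x * u x * cnj (a x)) = (LINT x|M. indicator A x * u x * cnj (b x))"
  shows "AE x in M. a x = b x"
proof (rule AE_by_bounded_sets)
  fix A assume A: "bounded_set A"
  define u where "u x = indicator A x * a x - indicator A x * b x" for x
  have u: "u \<in> L" unfolding u_def by (rule square_integrable_diff[OF aL bL]) fact+
  have i: "integrable M (\<lambda>x. u x * cnj (indicator A x * a x))"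
    "integrable M (\<lambda>x. u x * cnj (indicator A x * b x))"
    by (intro integrable_mult_cnj u aL bL A)+
  have "(LINT x|M. u x * cnj (indicator A x * a x)) = (LINT x|M. u x * cnj (indicator A x * b x))"
    using eq[OF A u] by (simp add: mult_ac)
  then have "0 = (LINT x|M. u x * cnj (indicator A x * a x) - u x * cnj (indicator A x * b x))"
    using i by simp
  \<comment> \<open>By the choice of \<open>u\<close>, the integrand is
    \<open>u x * cnj (u x)\<close>.\<close>
  also have "\<dots> = (LINT x|M. complex_of_real ((cmod (u x))\<^sup>2))"
    unfolding complex_norm_square by (simp add: u_def algebra_simps)
  finally have "(LINT x|M. (cmod (u x))\<^sup>2) = 0" by (simp del: of_real_power)
  then have "AE x in M. (cmod (u x))\<^sup>2 = 0"
    using u by (subst (asm) integral_nonneg_eq_0_iff_AE) (auto simp: square_integrable_def)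
  then show "AE x in M. x \<in> A \<longrightarrow> a x = b x"
    by eventually_elim (auto simp: u_def)
qed

text \<open>The domain contains all functions cut off to bounded sets, and these suffice to
  determine \<open>k\<close>.\<close>

lemma adjoint_value_unique:
  assumes k: "adjoint_value f k" and l: "adjoint_value f l"
  shows "AE x in M. k x = l x"
proof (rule cut_test_unique)
  show "k \<in> borel_measurable M" "l \<in> borel_measurable M"
    using k l by (auto simp: adjoint_value_def L_measurable)
  show "(\<lambda>x. indicator A x * k x) \<in> L" "(\<lambda>x. indicator A x * l x) \<in> L" if "bounded_set A" for A
    using k l cut_square_integrable[OF that] by (auto simp: adjoint_value_def)
  show "(LINT x|M. indicator A x * u x * cnj (k x)) = (LINT x|M. indicator A x * u x * cnj (l x))"
    if "bounded_set A" "u \<in> L" for A u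
    using adjoint_value_cut[OF k that] adjoint_value_cut[OF l that] by simp
qed

lemma integral_cong_AE_mult_cnj:
  assumes "AE x in M. f x = g x" "u \<in> borel_measurable M" "f \<in> borel_measurable M" "g \<in> borel_measurable M"
  shows "(LINT x|M. u x * cnj (f x)) = (LINT x|M. u x * cnj (g x))"
  by (rule integral_cong_AE) (use assms in \<open>auto elim: AE_mp\<close>)

lemma adjoint_value_cong:
  assumes k: "adjoint_value f k" and fg: "AE x in M. f x = g x" and kl: "AE x in M. k x = l x"
    and g: "g \<in> borel_measurable M" and l: "l \<in> borel_measurable M"
  shows "adjoint_value g l"
proof -
  have fk: "f \<in> L" "k \<in> L" using k by (auto simp: adjoint_value_def)
  have gl: "g \<in> L" "l \<in> L"
    using square_integrable_cong_AE[OF fk(1) g fg] square_integrable_cong_AE[OF fk(2) l kl] by auto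
  have "(LINT x|M. u (\<phi> x) * cnj (g x)) = (LINT x|M. u x * cnj (l x))"
    if u: "u \<in> L" "u \<circ> \<phi> \<in> L" for u
  proof -
    have "(LINT x|M. u (\<phi> x) * cnj (f x)) = (LINT x|M. u (\<phi> x) * cnj (g x))"
      using fg L_measurable[OF u(2)]
      by (intro integral_cong_AE_mult_cnj) (auto simp: fk gl L_measurable o_def)
    moreover have "(LINT x|M. u x * cnj (k x)) = (LINT x|M. u x * cnj (l x))"
      using kl u by (intro integral_cong_AE_mult_cnj) (auto simp: fk gl L_measurable)
    ultimately show ?thesis using k u by (simp add: adjoint_value_def)
  qed
  then show ?thesis using gl by (simp add: adjoint_value_def)
qed

text \<open>Every vector of the domain is the class of some \<open>u\<close> with \<open>u\<close>
  and \<open>u \<circ> \<phi>\<close> in \<open>L\<close>, so the condition on classes in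
  \<open>adjoint_operator\<close> becomes an identity between integrals of functions.\<close>

lemma adjoint_condition_iff:
  assumes f: "f \<in> L" and k: "k \<in> L"
  shows "(\<forall>F\<in>dom (composition_operator M \<phi>).
      vinner (L2_space M) (the (composition_operator M \<phi> F)) (ae_class M f) =
      vinner (L2_space M) F (ae_class M k)) \<longleftrightarrow> adjoint_value f k" (is "?lhs \<longleftrightarrow> _")
proof
  assume l: ?lhs
  have "(LINT x|M. u (\<phi> x) * cnj (f x)) = (LINT x|M. u x * cnj (k x))"
    if u: "u \<in> L" "u \<circ> \<phi> \<in> L" for u
    using bspec[OF l ae_class_domI[OF nonsingular u]]
    by (simp add: composition_operator_ae_class[OF nonsingular] u f k vinner_ae_class del: o_apply)
      (simp add: o_def)
  then show "adjoint_value f k" using f k by (simp add: adjoint_value_def)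
next
  assume a: "adjoint_value f k"
  show ?lhs
  proof
    fix F assume "F \<in> dom (composition_operator M \<phi>)"
    then obtain u where u: "u \<in> L" "u \<circ> \<phi> \<in> L" "F = ae_class M u"
      "composition_operator M \<phi> F = Some (ae_class M (u \<circ> \<phi>))"
      by (rule composition_operator_domE[OF nonsingular])
    then show "vinner (L2_space M) (the (composition_operator M \<phi> F)) (ae_class M f) =
        vinner (L2_space M) F (ae_class M k)"
      using a by (simp only: option.sel vinner_ae_class f k) (simp add: adjoint_value_def)
  qed
qed

text \<open>Adjoint values are unique up to null sets, so their class is unique and the definite
  description in \<open>adjoint_operator\<close> picks it.\<close>

lemma adjoint_eq_Some_iff:
  assumes f: "f \<in> L" and k: "k \<in> L"
  shows "adjoint_operator (L2_space M) (composition_operator M \<phi>) (ae_class M f) =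
    Some (ae_class M k) \<longleftrightarrow> adjoint_value f k" (is "?adj = _ \<longleftrightarrow> _")
proof -
  define P where "P K \<longleftrightarrow> K \<in> vecs (L2_space M) \<and> (\<forall>F\<in>dom (composition_operator M \<phi>).
      vinner (L2_space M) (the (composition_operator M \<phi> F)) (ae_class M f) =
      vinner (L2_space M) F K)" for K
  have P: "P (ae_class M l) \<longleftrightarrow> adjoint_value f l" if "l \<in> L" for l
    unfolding P_def using adjoint_condition_iff[OF f that] ae_class_in_L2[OF that] by simp
  have unique: "K = K'" if KK': "P K" "P K'" for K K'
  proof -
    obtain l where l: "l \<in> L" "K = ae_class M l"
      using KK'(1) unfolding P_def by (elim conjE L2_space_cases)
    obtain l' where l': "l' \<in> L" "K' = ae_class M l'"
      using KK'(2) unfolding P_def by (elim conjE L2_space_cases)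
    have "adjoint_value f l" "adjoint_value f l'" using KK' P l l' by simp_all
    then show ?thesis using adjoint_value_unique l l' by (simp add: ae_class_eq_iff)
  qed
  have adj: "?adj = (if \<exists>K. P K then Some (THE K. P K) else None)"
    unfolding P_def using ae_class_in_L2[OF f] by (simp add: adjoint_operator_def Bex_def)
  have the: "(THE K. P K) = K" if "P K" for K
    using that by (intro the_equality unique)
  have "?adj = Some (ae_class M k) \<longleftrightarrow> P (ae_class M k)"
    unfolding adj using the by auto
  then show ?thesis using P[OF k] by simp
qed

lemma adjoint_eq_SomeE:
  assumes "adjoint_operator (L2_space M) (composition_operator M \<phi>) F = Some K"
  obtains f k where "F = ae_class M f" "K = ae_class M k" "adjoint_value f k"
proof -
  have F: "F \<in> vecs (L2_space M)" and ex: "\<exists>K\<in>vecs (L2_space M). \<forall>G\<in>dom (composition_operator M \<phi>).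
      vinner (L2_space M) (the (composition_operator M \<phi> G)) F = vinner (L2_space M) G K"
    using assms unfolding adjoint_operator_def by (auto split: if_splits)
  obtain f where f: "f \<in> L" "F = ae_class M f" using F by (rule L2_space_cases)
  obtain K' where K': "K' \<in> vecs (L2_space M)" "\<forall>G\<in>dom (composition_operator M \<phi>).
      vinner (L2_space M) (the (composition_operator M \<phi> G)) F = vinner (L2_space M) G K'"
    using ex by (elim bexE)
  obtain k where k: "k \<in> L" "K' = ae_class M k" using K'(1) by (rule L2_space_cases)
  have a: "adjoint_value f k"
    using K'(2) unfolding f(2) k(2) adjoint_condition_iff[OF f(1) k(1)] .
  then have "K = ae_class M k" using adjoint_eq_Some_iff[OF f(1) k(1)] assms f(2) by simp
  then show ?thesis using that f k a by simp
qed

text \<open>This is \<open>C\<^sup>*Cf = hf\<close>, by change of variables. As \<open>f\<close> is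
  merely measurable, the formula also covers a factor \<open>v\<close> that is not itself square
  integrable.\<close>

lemma adjoint_value_comp:
  assumes f: "f \<in> borel_measurable M" "f \<circ> \<phi> \<in> L" and hf: "(\<lambda>x. of_real (h x) * f x) \<in> L"
  shows "adjoint_value (f \<circ> \<phi>) (\<lambda>x. of_real (h x) * f x)"
  unfolding adjoint_value_def
proof (intro conjI ballI impI)
  fix u assume u: "u \<in> L" "u \<circ> \<phi> \<in> L"
  have [measurable]: "f \<in> borel_measurable M" "u \<in> borel_measurable M" using f u by (auto simp: L_measurable)
  show "(LINT x|M. u (\<phi> x) * cnj ((f \<circ> \<phi>) x)) = (LINT x|M. u x * cnj (of_real (h x) * f x))"
    using integral_comp[of "\<lambda>x. u x * cnj (f x)"] by (simp add: scaleR_conv_of_real mult_ac)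
qed (use assms in auto)

section \<open>The adjoint on indicators: positivity and null sets\<close>

text \<open>For a real test function the left side of the adjoint identity is real, so the real and
  the imaginary part of \<open>a\<close> can be tested separately.\<close>

lemma adjoint_value_indicator_real_test:
  fixes r :: "'a \<Rightarrow> real"
  assumes a: "adjoint_value (indicator A) a" and E: "bounded_set E"
    and r: "(\<lambda>x. complex_of_real (r x)) \<in> L"
  shows "(LINT x|M. indicator E (\<phi> x) * r (\<phi> x) * indicator A x) =
      (LINT x|M. indicator E x * r x * Re (a x))"
    and "(LINT x|M. indicator E x * r x * Im (a x)) = 0"
    and "integrable M (\<lambda>x. indicator E (\<phi> x) * r (\<phi> x) * indicator A x)"
    and "integrable M (\<lambda>x. indicator E x * r x * Re (a x))"
    and "integrable M (\<lambda>x. indicator E x * r x * Im (a x))"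
proof -
  have A: "indicator A \<in> L" and aL: "a \<in> L" using a by (auto simp: adjoint_value_def)
  have eq: "(LINT x|M. complex_of_real (indicator E (\<phi> x) * r (\<phi> x) * indicator A x)) =
      (LINT x|M. indicator E x * complex_of_real (r x) * cnj (a x))"
    using adjoint_value_cut[OF a E r] by (simp add: of_real_indicator)
  have i: "integrable M (\<lambda>x. indicator E x * complex_of_real (r x) * cnj (a x))"
    using integrable_mult_cnj[OF cut_square_integrable(1)[OF E r] aL] by simp
  have re: "Re (indicator E x * complex_of_real (r x) * cnj (a x)) = indicator E x * r x * Re (a x)"
    and im: "Im (indicator E x * complex_of_real (r x) * cnj (a x)) = - (indicator E x * r x * Im (a x))" for x
    by (auto split: split_indicator)
  show "integrable M (\<lambda>x. indicator E (\<phi> x) * r (\<phi> x) * indicator A x)"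
    using integrable_Re[OF integrable_mult_cnj[OF cut_square_integrable(2)[OF E r] A]]
    by (rule Bochner_Integration.integrable_cong[THEN iffD1, rotated 2])
      (auto split: split_indicator)
  show "integrable M (\<lambda>x. indicator E x * r x * Re (a x))"
    using integrable_Re[OF i] by (simp only: re)
  show "integrable M (\<lambda>x. indicator E x * r x * Im (a x))"
    using Bochner_Integration.integrable_minus[OF integrable_Im[OF i]] by (simp only: im minus_minus)
  show "(LINT x|M. indicator E (\<phi> x) * r (\<phi> x) * indicator A x) =
      (LINT x|M. indicator E x * r x * Re (a x))"
    using arg_cong[OF eq, of Re] integral_Re[OF i]
    unfolding integral_complex_of_real re by simp
  show "(LINT x|M. indicator E x * r x * Im (a x)) = 0"
    using arg_cong[OF eq, of Im] integral_Im[OF i]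
    unfolding integral_complex_of_real im by simp
qed

text \<open>Testing with \<open>min (Re (a x)) 0\<close> gives a nonpositive integral on the side of
  \<open>\<phi>\<close> and a nonnegative one on the side of \<open>a\<close>, so both vanish.
  Testing with \<open>Im (a x)\<close> shows that the integral of its square over \<open>E\<close>
  is zero.\<close>

lemma adjoint_value_indicator_nonneg:
  assumes a: "adjoint_value (indicator A) a"
  shows "AE x in M. Im (a x) = 0 \<and> 0 \<le> Re (a x)"
proof (rule AE_by_bounded_sets)
  fix E assume E: "bounded_set E"
  have aL: "a \<in> L" using a by (simp add: adjoint_value_def)
  then have [measurable]: "a \<in> borel_measurable M" by (rule L_measurable)
  let ?r = "\<lambda>x. min (Re (a x)) 0"
  have r: "(\<lambda>x. complex_of_real (?r x)) \<in> L"
    by (rule square_integrable_bounded_by[OF aL, of _ 1])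
      (auto simp: min_def cmod_power2 intro!: AE_I2)
  have s: "(\<lambda>x. complex_of_real (Im (a x))) \<in> L"
    by (rule square_integrable_bounded_by[OF aL, of _ 1])
      (auto simp: cmod_power2 intro!: AE_I2)
  note R = adjoint_value_indicator_real_test[OF a E r]
  note S = adjoint_value_indicator_real_test[OF a E s]
  have nonneg: "0 \<le> indicator E x * ?r x * Re (a x)" for x
    by (auto simp: min_def mult_nonpos_nonpos split: split_indicator)
  have "0 \<le> (LINT x|M. - (indicator E (\<phi> x) * ?r (\<phi> x) * indicator A x))"
    by (rule Bochner_Integration.integral_nonneg) (auto split: split_indicator)
  then have "(LINT x|M. indicator E (\<phi> x) * ?r (\<phi> x) * indicator A x) \<le> 0"
    by simp
  then have "(LINT x|M. indicator E x * ?r x * Re (a x)) = 0"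
    unfolding R(1) using Bochner_Integration.integral_nonneg[of M "\<lambda>x. indicator E x * ?r x * Re (a x)", OF nonneg]
    by linarith
  then have 1: "AE x in M. indicator E x * ?r x * Re (a x) = 0"
    using integral_nonneg_eq_0_iff_AE[OF R(4)] nonneg by blast
  have 2: "AE x in M. indicator E x * Im (a x) * Im (a x) = 0"
    using integral_nonneg_eq_0_iff_AE[OF S(5)] S(2) by (auto split: split_indicator)
  show "AE x in M. x \<in> E \<longrightarrow> Im (a x) = 0 \<and> 0 \<le> Re (a x)"
    using 1 2 by eventually_elim (auto simp: min_def split: if_splits)
qed

text \<open>Testing with the indicator of \<open>E \<inter> D\<close> expresses the measure of the
  part of \<open>A\<close> that \<open>\<phi>\<close> sends into \<open>E \<inter> D\<close> as the
  integral of \<open>Re (a x)\<close> over \<open>E \<inter> D\<close>, which is zero.\<close>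

lemma adjoint_value_indicator_null:
  assumes a: "adjoint_value (indicator A) a" and [measurable]: "D \<in> sets M"
    and ae: "AE x in M. x \<in> D \<longrightarrow> a x = 0"
  shows "AE x in M. \<not> (x \<in> A \<and> \<phi> x \<in> D)"
proof (rule AE_by_bounded_preimages)
  fix E assume E: "bounded_set E"
  then have ED: "bounded_set (E \<inter> D)"
    by (intro bounded_set_subset[OF E]) (auto simp: bounded_set_def)
  have r: "(\<lambda>x. complex_of_real (indicator (E \<inter> D) x)) \<in> L"
    using bounded_indicator(1)[OF ED] by (simp add: of_real_indicator)
  \<comment> \<open>The same indicator serves as cut-off and as test function, hence the doubled
    factors below.\<close>
  note R = adjoint_value_indicator_real_test[OF a ED r]
  have "(LINT x|M. indicator (E \<inter> D) x * indicator (E \<inter> D) x * Re (a x)) = 0"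
    by (rule integral_eq_zero_AE) (use ae in \<open>auto split: split_indicator\<close>)
  then have "(LINT x|M. indicator (E \<inter> D) (\<phi> x) * indicator (E \<inter> D) (\<phi> x) * (indicator A x :: real)) = 0"
    using R(1) by simp
  then have "AE x in M. indicator (E \<inter> D) (\<phi> x) * indicator (E \<inter> D) (\<phi> x) * (indicator A x :: real) = 0"
    using integral_nonneg_eq_0_iff_AE[OF R(3)] by simp
  then show "AE x in M. \<phi> x \<in> E \<longrightarrow> \<not> (x \<in> A \<and> \<phi> x \<in> D)"
    by eventually_elim (auto split: split_indicator_asm)
qed

lemma adjoint_value_add:
  assumes f: "adjoint_value f k" and g: "adjoint_value g l"
  shows "adjoint_value (\<lambda>x. f x + g x) (\<lambda>x. k x + l x)"
proof -
  have L: "f \<in> L" "k \<in> L" "g \<in> L" "l \<in> L" using f g by (auto simp: adjoint_value_def)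
  have "(LINT x|M. u (\<phi> x) * cnj (f x + g x)) = (LINT x|M. u x * cnj (k x + l x))"
    if u: "u \<in> L" "u \<circ> \<phi> \<in> L" for u
  proof -
    have i: "integrable M (\<lambda>x. u (\<phi> x) * cnj (f x))" "integrable M (\<lambda>x. u (\<phi> x) * cnj (g x))"
      "integrable M (\<lambda>x. u x * cnj (k x))" "integrable M (\<lambda>x. u x * cnj (l x))"
      using integrable_mult_cnj[OF u(2) L(1)] integrable_mult_cnj[OF u(2) L(3)]
        integrable_mult_cnj[OF u(1) L(2)] integrable_mult_cnj[OF u(1) L(4)] by simp_all
    show ?thesis
      using f g u i by (simp add: adjoint_value_def distrib_left)
  qed
  then show ?thesis using L by (simp add: adjoint_value_def square_integrable_add)
qed

section \<open>The norm identity on indicators: preimages and invariance of the density\<close>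

text \<open>The common consequence of both notions of normality; the right side is the squared norm
  of \<open>C1\<^sub>A\<close> after change of variables. For a densely defined operator it implies
  each of the two notions in turn.\<close>

definition normal_on_indicators :: bool where
  "normal_on_indicators \<longleftrightarrow> (\<forall>A. bounded_set A \<longrightarrow>
     (\<exists>a. adjoint_value (indicator A) a \<and>
       (LINT x|M. (cmod (a x))\<^sup>2) = (LINT x|M. indicator A x * h x)))"

lemma integrable_indicator_h:
  assumes "bounded_set A"
  shows "integrable M (\<lambda>x. indicator A x * h x)"
proof -
  obtain c where c: "\<And>x. x \<in> A \<Longrightarrow> h x \<le> c" using assms by (auto simp: bounded_set_def)
  have A: "A \<in> sets M" "emeasure M A < \<infinity>" using assms by (auto simp: bounded_set_def)
  then have i: "integrable M (\<lambda>x. indicator A x * c)"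
    by (intro integrable_mult_left) simp
  show ?thesis
    by (rule Bochner_Integration.integrable_bound[OF i])
      (use A c h_nonneg in \<open>auto intro!: AE_I2 split: split_indicator simp: order_trans[OF c abs_ge_self]\<close>)
qed

text \<open>Adjoint values agree almost everywhere, so the norm identity passes from one of them to
  all.\<close>

lemma adjoint_value_indicator_norm:
  assumes N: normal_on_indicators and A: "bounded_set A" and a: "adjoint_value (indicator A) a"
  shows "(LINT x|M. (cmod (a x))\<^sup>2) = (LINT x|M. indicator A x * h x)"
proof -
  obtain a' where a': "adjoint_value (indicator A) a'"
    "(LINT x|M. (cmod (a' x))\<^sup>2) = (LINT x|M. indicator A x * h x)"
    using N A unfolding normal_on_indicators_def by blast
  have [measurable]: "a \<in> borel_measurable M" "a' \<in> borel_measurable M"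
    using a a' by (auto simp: adjoint_value_def L_measurable)
  have "(LINT x|M. (cmod (a x))\<^sup>2) = (LINT x|M. (cmod (a' x))\<^sup>2)"
    by (rule integral_cong_AE) (use adjoint_value_unique[OF a a'(1)] in auto)
  then show ?thesis using a' by simp
qed

text \<open>Comparing norms for \<open>A\<close>, \<open>B\<close> and \<open>A \<union> B\<close> shows that \<open>a\<close> and \<open>b\<close> are orthogonal, and both are
  nonnegative.\<close>

lemma adjoint_value_disjoint:
  assumes N: normal_on_indicators and A: "bounded_set A" and B: "bounded_set B" and AB: "A \<inter> B = {}"
    and a: "adjoint_value (indicator A) a" and b: "adjoint_value (indicator B) b"
  shows "AE x in M. a x = 0 \<or> b x = 0"
proof -
  have L: "a \<in> L" "b \<in> L" using a b by (auto simp: adjoint_value_def)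
  have i: "integrable M (\<lambda>x. (cmod (a x))\<^sup>2)" "integrable M (\<lambda>x. (cmod (b x))\<^sup>2)"
    using L by (auto simp: square_integrable_def)
  have j: "integrable M (\<lambda>x. Re (a x * cnj (b x)))"
    by (intro integrable_Re integrable_mult_cnj L)
  have ind: "indicator (A \<union> B) x = indicator A x + (indicator B x :: 'b::ring_1)" for x
    using AB by (auto split: split_indicator)
  have "adjoint_value (indicator (A \<union> B)) (\<lambda>x. a x + b x)"
    using adjoint_value_add[OF a b] by (simp add: ind[abs_def])
  then have "(LINT x|M. (cmod (a x + b x))\<^sup>2) = (LINT x|M. indicator (A \<union> B) x * h x)"
    by (rule adjoint_value_indicator_norm[OF N bounded_set_Un[OF A B]])
  also have "\<dots> = (LINT x|M. indicator A x * h x) + (LINT x|M. indicator B x * h x)"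
    using integrable_indicator_h A B by (simp add: ind distrib_right)
  also have "\<dots> = (LINT x|M. (cmod (a x))\<^sup>2) + (LINT x|M. (cmod (b x))\<^sup>2)"
    using adjoint_value_indicator_norm[OF N A a] adjoint_value_indicator_norm[OF N B b] by simp
  finally have eq: "(LINT x|M. (cmod (a x + b x))\<^sup>2) = \<dots>" .
  have "(cmod (a x + b x))\<^sup>2 = (cmod (a x))\<^sup>2 + (cmod (b x))\<^sup>2 + 2 * Re (a x * cnj (b x))" for x
    unfolding cmod_power2 by (simp add: power2_eq_square algebra_simps)
  then have "(LINT x|M. (cmod (a x + b x))\<^sup>2) =
      (LINT x|M. (cmod (a x))\<^sup>2) + (LINT x|M. (cmod (b x))\<^sup>2) + 2 * (LINT x|M. Re (a x * cnj (b x)))"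
    using i j by (simp del: times_complex.sel)
  with eq have "(LINT x|M. Re (a x * cnj (b x))) = 0" by linarith
  moreover have nn: "AE x in M. 0 \<le> Re (a x * cnj (b x))"
    using adjoint_value_indicator_nonneg[OF a] adjoint_value_indicator_nonneg[OF b]
    by eventually_elim simp
  ultimately have "AE x in M. Re (a x * cnj (b x)) = 0"
    using integral_nonneg_eq_0_iff_AE[OF j nn] by blast
  then show ?thesis
    using adjoint_value_indicator_nonneg[OF a] adjoint_value_indicator_nonneg[OF b]
    by eventually_elim (auto simp: complex_eq_iff)
qed

text \<open>Almost no point of \<open>A\<close> is sent to a zero of \<open>a\<close>, which gives
  one inclusion. For the other, the adjoint value of the indicator of \<open>B - A\<close> vanishes
  on \<open>D\<close> by disjointness of supports, so almost no point of \<open>B - A\<close> is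
  sent into \<open>D\<close>.\<close>

lemma bounded_set_is_preimage:
  assumes N: normal_on_indicators and A: "bounded_set A" and a: "adjoint_value (indicator A) a"
  defines "D \<equiv> {x \<in> space M. a x \<noteq> 0}"
  shows "AE x in M. x \<in> A \<longleftrightarrow> \<phi> x \<in> D"
proof -
  have [measurable]: "a \<in> borel_measurable M" using a by (auto simp: adjoint_value_def L_measurable)
  have D [measurable]: "D \<in> sets M" unfolding D_def by measurable
  have [measurable]: "A \<in> sets M" using A by (simp add: bounded_set_def)
  have "AE x in M. \<not> (x \<in> A \<and> \<phi> x \<in> {x \<in> space M. a x = 0})"
    by (rule adjoint_value_indicator_null[OF a]) auto
  then have 1: "AE x in M. x \<in> A \<longrightarrow> \<phi> x \<in> D"
    using AE_space by eventually_elim (use measurable_space[OF phi_measurable] in \<open>auto simp: D_def\<close>)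
  have 2: "AE x in M. \<phi> x \<in> D \<longrightarrow> x \<in> A"
  proof (rule AE_by_bounded_sets)
    fix B assume B: "bounded_set B"
    then have BA: "bounded_set (B - A)"
      by (intro bounded_set_subset[OF B]) (auto simp: bounded_set_def)
    then obtain b where b: "adjoint_value (indicator (B - A)) b"
      using N unfolding normal_on_indicators_def by blast
    have "AE x in M. a x = 0 \<or> b x = 0"
      by (rule adjoint_value_disjoint[OF N A BA _ a b]) auto
    then have "AE x in M. x \<in> D \<longrightarrow> b x = 0"
      by eventually_elim (auto simp: D_def)
    from adjoint_value_indicator_null[OF b D this]
    show "AE x in M. x \<in> B \<longrightarrow> \<phi> x \<in> D \<longrightarrow> x \<in> A"
      by eventually_elim auto
  qed
  show ?thesis using 1 2 by eventually_elim auto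
qed

text \<open>The exhaustion covers \<open>A\<close> by countably many bounded pieces, and the union
  of the sets \<open>D n\<close> found for them serves for \<open>A\<close>.\<close>

lemma set_is_preimage:
  assumes N: normal_on_indicators and [measurable]: "A \<in> sets M"
  shows "\<exists>D\<in>sets M. AE x in M. x \<in> A \<longleftrightarrow> \<phi> x \<in> D"
proof -
  obtain E :: "nat \<Rightarrow> 'a set" where E: "\<And>n. bounded_set (E n)" "(\<Union>n. E n) = space M"
    using bounded_exhaustion by metis
  have "\<exists>D\<in>sets M. AE x in M. x \<in> A \<inter> E n \<longleftrightarrow> \<phi> x \<in> D" for n
  proof -
    have AE: "bounded_set (A \<inter> E n)"
      using E(1)[of n] by (intro bounded_set_subset[OF E(1)[of n]]) (auto simp: bounded_set_def)
    then obtain a where a: "adjoint_value (indicator (A \<inter> E n)) a"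
      using N unfolding normal_on_indicators_def by blast
    then have [measurable]: "a \<in> borel_measurable M" by (auto simp: adjoint_value_def L_measurable)
    have "{x \<in> space M. a x \<noteq> 0} \<in> sets M" by measurable
    then show ?thesis using bounded_set_is_preimage[OF N AE a] by blast
  qed
  then obtain D where D: "\<And>n. D n \<in> sets M" "\<And>n. AE x in M. x \<in> A \<inter> E n \<longleftrightarrow> \<phi> x \<in> D n"
    by metis
  have "AE x in M. \<forall>n. x \<in> A \<inter> E n \<longleftrightarrow> \<phi> x \<in> D n"
    unfolding AE_all_countable using D(2) by blast
  then have "AE x in M. x \<in> A \<longleftrightarrow> \<phi> x \<in> (\<Union>n. D n)"
    using AE_space
  proof eventually_elim
    case (elim x)
    then obtain n where "x \<in> E n" using E(2) by blast
    then show ?case using elim(1) by auto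
  qed
  then show ?thesis using D(1) by blast
qed

text \<open>The indicator of \<open>A\<close> is that of \<open>D\<close> composed with
  \<open>\<phi>\<close>, so change of variables moves it to the other side and produces the weight
  \<open>h\<close>. Cut-off test functions are used because square integrability of \<open>h\<close>
  on \<open>D\<close> is part of what is obtained.\<close>

lemma adjoint_value_preimage:
  assumes a: "adjoint_value (indicator A) a" and [measurable]: "A \<in> sets M" "D \<in> sets M"
    and AD: "AE x in M. x \<in> A \<longleftrightarrow> \<phi> x \<in> D"
  shows "AE x in M. a x = indicator D x * of_real (h x)"
proof (rule cut_test_unique)
  have aL: "a \<in> L" using a by (simp add: adjoint_value_def)
  then show [measurable]: "a \<in> borel_measurable M" by (rule L_measurable)
  show "(\<lambda>x. indicator D x * complex_of_real (h x)) \<in> borel_measurable M" by measurable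
  fix E assume E: "bounded_set E"
  then have [measurable]: "E \<in> sets M" by (simp add: bounded_set_def)
  show "(\<lambda>x. indicator E x * a x) \<in> L" by (rule cut_square_integrable[OF E aL])
  obtain c where c: "\<And>x. x \<in> E \<Longrightarrow> h x \<le> c" using E by (auto simp: bounded_set_def)
  show "(\<lambda>x. indicator E x * (indicator D x * complex_of_real (h x))) \<in> L"
    by (rule square_integrable_bounded_by[OF bounded_indicator(1)[OF E], of _ "c\<^sup>2"])
      (auto intro!: AE_I2 power_mono c h_nonneg split: split_indicator)
  fix u assume u: "u \<in> L"
  then have [measurable]: "u \<in> borel_measurable M" by (rule L_measurable)
  have "(LINT x|M. indicator E x * u x * cnj (a x)) =
      (LINT x|M. indicator E (\<phi> x) * u (\<phi> x) * cnj (indicator A x))"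
    using adjoint_value_cut[OF a E u] by simp
  also have "\<dots> = (LINT x|M. indicator E (\<phi> x) * u (\<phi> x) * indicator D (\<phi> x))"
    by (rule integral_cong_AE) (use AD in \<open>auto elim!: eventually_mono split: split_indicator\<close>)
  also have "\<dots> = (LINT x|M. of_real (h x) * (indicator E x * u x * indicator D x))"
    using integral_comp[of "\<lambda>x. indicator E x * u x * indicator D x"]
    by (simp add: scaleR_conv_of_real)
  finally show "(LINT x|M. indicator E x * u x * cnj (a x)) =
      (LINT x|M. indicator E x * u x * cnj (indicator D x * complex_of_real (h x)))"
    by (simp add: mult_ac)
qed

text \<open>Both sides equal the squared norm of \<open>C\<^sup>*1\<^sub>A\<close>: the left one by
  the norm identity; the right one because \<open>C\<^sup>*1\<^sub>A = h1\<^sub>D\<close>, where one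
  of the two factors \<open>h\<close> in the square is absorbed by change of variables.\<close>

lemma nn_integral_h_invariant:
  assumes N: normal_on_indicators and A: "bounded_set A"
  shows "(\<integral>\<^sup>+x. ennreal (h x) * indicator A x \<partial>M) = (\<integral>\<^sup>+x. ennreal (h (\<phi> x)) * indicator A x \<partial>M)"
proof -
  have [measurable]: "A \<in> sets M" using A by (simp add: bounded_set_def)
  obtain D where [measurable]: "D \<in> sets M" and AD: "AE x in M. x \<in> A \<longleftrightarrow> \<phi> x \<in> D"
    using set_is_preimage[OF N, of A] by auto
  obtain a where a: "adjoint_value (indicator A) a"
    using N A unfolding normal_on_indicators_def by blast
  then have aL: "a \<in> L" by (simp add: adjoint_value_def)
  have "(\<integral>\<^sup>+x. ennreal (h x) * indicator A x \<partial>M) = (\<integral>\<^sup>+x. ennreal (indicator A x * h x) \<partial>M)"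
    by (intro nn_integral_cong) (auto split: split_indicator)
  also have "\<dots> = ennreal (LINT x|M. indicator A x * h x)"
    by (intro nn_integral_eq_integral integrable_indicator_h A) (simp add: h_nonneg)
  also have "\<dots> = ennreal (LINT x|M. (cmod (a x))\<^sup>2)"
    using adjoint_value_indicator_norm[OF N A a] by simp
  also have "\<dots> = (\<integral>\<^sup>+x. ennreal ((cmod (a x))\<^sup>2) \<partial>M)"
    using aL by (intro nn_integral_eq_integral[symmetric]) (auto simp: square_integrable_def)
  also have "\<dots> = (\<integral>\<^sup>+x. ennreal (h x) * (ennreal (h x) * indicator D x) \<partial>M)"
    using adjoint_value_preimage[OF a _ _ AD]
    by (intro nn_integral_cong_AE)
      (auto elim!: eventually_mono simp: norm_mult power2_eq_square h_nonneg ennreal_mult split: split_indicator)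
  also have "\<dots> = (\<integral>\<^sup>+x. ennreal (h (\<phi> x)) * indicator D (\<phi> x) \<partial>M)"
    by (rule nn_integral_comp[symmetric]) measurable
  also have "\<dots> = (\<integral>\<^sup>+x. ennreal (h (\<phi> x)) * indicator A x \<partial>M)"
    by (intro nn_integral_cong_AE) (use AD in \<open>auto elim!: eventually_mono split: split_indicator\<close>)
  finally show ?thesis .
qed

text \<open>Equal integrals over all measurable subsets of a bounded set \<open>A\<close> make the
  two densities agree almost everywhere on \<open>A\<close>.\<close>

lemma h_invariant:
  assumes N: normal_on_indicators
  shows "AE x in M. h (\<phi> x) = h x"
proof (rule AE_by_bounded_sets)
  fix A assume A: "bounded_set A"
  have [measurable]: "A \<in> sets M" using A by (simp add: bounded_set_def)
  have "AE x in M. ennreal (h x) * indicator A x = ennreal (h (\<phi> x)) * indicator A x"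
  proof (rule density_unique)
    show "density M (\<lambda>x. ennreal (h x) * indicator A x) = density M (\<lambda>x. ennreal (h (\<phi> x)) * indicator A x)"
    proof (rule measure_eqI)
      fix B assume "B \<in> sets (density M (\<lambda>x. ennreal (h x) * indicator A x))"
      then have [measurable]: "B \<in> sets M" by simp
      have AB: "bounded_set (A \<inter> B)"
        by (rule bounded_set_subset[OF A]) auto
      show "emeasure (density M (\<lambda>x. ennreal (h x) * indicator A x)) B =
          emeasure (density M (\<lambda>x. ennreal (h (\<phi> x)) * indicator A x)) B"
        using nn_integral_h_invariant[OF N AB]
        by (simp add: emeasure_density indicator_inter_arith mult.assoc)
    qed simp
  qed measurable
  then show "AE x in M. x \<in> A \<longrightarrow> h (\<phi> x) = h x"
    by eventually_elim (auto simp: h_nonneg)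
qed

section \<open>From the operator conditions to indicators\<close>

lemma adjoint_dom_iff:
  assumes f: "f \<in> L"
  shows "ae_class M f \<in> dom (adjoint_operator (L2_space M) (composition_operator M \<phi>)) \<longleftrightarrow>
    (\<exists>k. adjoint_value f k)" (is "_ \<in> dom ?A \<longleftrightarrow> _")
proof
  assume "ae_class M f \<in> dom ?A"
  then obtain K where "?A (ae_class M f) = Some K" by blast
  then obtain f' k where fk: "ae_class M f = ae_class M f'" "adjoint_value f' k"
    by (rule adjoint_eq_SomeE)
  then have "f' \<in> L" "k \<in> L" by (auto simp: adjoint_value_def)
  moreover from this have "AE x in M. f' x = f x"
    using fk(1) f by (simp add: ae_class_eq_iff eq_commute)
  ultimately show "\<exists>k. adjoint_value f k"
    using adjoint_value_cong[OF fk(2), of f k] f L_measurable by auto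
next
  assume "\<exists>k. adjoint_value f k"
  then obtain k where k: "adjoint_value f k" by blast
  then have "k \<in> L" by (simp add: adjoint_value_def)
  then show "ae_class M f \<in> dom ?A" using adjoint_eq_Some_iff[OF f] k by blast
qed

lemma integral_indicator_comp:
  assumes "bounded_set A"
  shows "(LINT x|M. (cmod ((indicator A \<circ> \<phi>) x))\<^sup>2) = (LINT x|M. indicator A x * h x)"
proof -
  have [measurable]: "A \<in> sets M" using assms by (simp add: bounded_set_def)
  have "(cmod ((indicator A \<circ> \<phi>) x))\<^sup>2 = indicator A (\<phi> x)" for x
    by (auto split: split_indicator)
  then show ?thesis using integral_comp[of "indicator A :: 'a \<Rightarrow> real"] by (simp add: mult.commute)
qed

text \<open>Indicators of bounded sets lie in the domain, so the norm equality applies to them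
  directly.\<close>

lemma formally_normal_imp_normal_on_indicators:
  assumes "formally_normal_operator (L2_space M) (composition_operator M \<phi>)"
  shows normal_on_indicators
  unfolding normal_on_indicators_def
proof (intro allI impI)
  let ?C = "composition_operator M \<phi>" let ?A = "adjoint_operator (L2_space M) ?C"
  fix A assume A: "bounded_set A"
  note f = bounded_indicator[OF A]
  let ?f = "ae_class M (indicator A)"
  have d: "?f \<in> dom ?C" by (rule ae_class_domI[OF nonsingular f])
  then have "?f \<in> dom ?A" and eq: "vnorm (L2_space M) (the (?C ?f)) = vnorm (L2_space M) (the (?A ?f))"
    using assms by (auto simp only: formally_normal_operator_def)
  then obtain k where k: "adjoint_value (indicator A) k" using adjoint_dom_iff[OF f(1)] by blast
  then have kL: "k \<in> L" by (simp add: adjoint_value_def)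
  have "?A ?f = Some (ae_class M k)" using adjoint_eq_Some_iff[OF f(1) kL] k by simp
  moreover have "?C ?f = Some (ae_class M (indicator A \<circ> \<phi>))"
    using f by (simp add: composition_operator_ae_class[OF nonsingular])
  ultimately have "sqrt (LINT x|M. (cmod ((indicator A \<circ> \<phi>) x))\<^sup>2) = sqrt (LINT x|M. (cmod (k x))\<^sup>2)"
    using eq by (simp only: option.sel vnorm_ae_class[OF f(2)] vnorm_ae_class[OF kL])
  then show "\<exists>a. adjoint_value (indicator A) a \<and>
      (LINT x|M. (cmod (a x))\<^sup>2) = (LINT x|M. indicator A x * h x)"
    using k integral_indicator_comp[OF A] by auto
qed

text \<open>Here \<open>a = C\<^sup>*1\<^sub>A\<close> satisfies \<open>a \<circ> \<phi> = CC\<^sup>*1\<^sub>A = C\<^sup>*C1\<^sub>A = h1\<^sub>A\<close>, and the norm of \<open>a\<close>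
  is computed by testing against \<open>a\<close> itself.\<close>

lemma normal_imp_normal_on_indicators:
  assumes "normal_operator (L2_space M) (composition_operator M \<phi>)"
  shows normal_on_indicators
  unfolding normal_on_indicators_def
proof (intro allI impI)
  let ?C = "composition_operator M \<phi>" let ?A = "adjoint_operator (L2_space M) ?C"
  fix A assume A: "bounded_set A"
  then have [measurable]: "A \<in> sets M" by (simp add: bounded_set_def)
  note f = bounded_indicator[OF A]
  let ?f = "ae_class M (indicator A)" and ?hf = "\<lambda>x. complex_of_real (h x) * indicator A x"
  obtain c where c: "\<And>x. x \<in> A \<Longrightarrow> h x \<le> c" using A by (auto simp: bounded_set_def)
  have hf: "?hf \<in> L"
    by (rule square_integrable_bounded_by[OF f(1), of _ "c\<^sup>2"])
      (auto intro!: AE_I2 power_mono c h_nonneg split: split_indicator)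
  have "adjoint_value (indicator A \<circ> \<phi>) ?hf"
    by (rule adjoint_value_comp[OF _ f(2) hf]) measurable
  then have "(?A \<circ>\<^sub>m ?C) ?f = Some (ae_class M ?hf)"
    using f adjoint_eq_Some_iff[OF f(2) hf]
    by (simp add: map_comp_def composition_operator_ae_class[OF nonsingular])
  then have "(?C \<circ>\<^sub>m ?A) ?f = Some (ae_class M ?hf)"
    using assms by (simp add: normal_operator_def)
  then obtain K where K: "?A ?f = Some K" "?C K = Some (ae_class M ?hf)"
    by (auto simp: map_comp_def split: option.splits)
  then obtain k where k: "adjoint_value (indicator A) k" using adjoint_dom_iff[OF f(1)] by blast
  then have kL: "k \<in> L" by (simp add: adjoint_value_def)
  then have [measurable]: "k \<in> borel_measurable M" by (rule L_measurable)
  have "K = ae_class M k" using adjoint_eq_Some_iff[OF f(1) kL] k K(1) by simp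
  then have ae: "AE x in M. k (\<phi> x) = ?hf x"
    using K(2) composition_operator_eq_Some_iff[OF nonsingular kL hf] by simp
  have kphi: "k \<circ> \<phi> \<in> L"
    by (rule square_integrable_cong_AE[OF hf]) (use ae in \<open>auto elim: eventually_mono simp: o_def\<close>)
  have "(LINT x|M. complex_of_real ((cmod (k x))\<^sup>2)) = (LINT x|M. k x * cnj (k x))"
    by (simp only: complex_norm_square)
  also have "\<dots> = (LINT x|M. k (\<phi> x) * cnj (indicator A x))"
    using k kL kphi by (simp add: adjoint_value_def)
  also have "\<dots> = (LINT x|M. complex_of_real (indicator A x * h x))"
    by (rule integral_cong_AE) (use ae in \<open>auto elim!: eventually_mono split: split_indicator\<close>)
  finally have "(LINT x|M. (cmod (k x))\<^sup>2) = (LINT x|M. indicator A x * h x)"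
    unfolding integral_complex_of_real of_real_eq_iff .
  with k show "\<exists>a. adjoint_value (indicator A) a \<and>
      (LINT x|M. (cmod (a x))\<^sup>2) = (LINT x|M. indicator A x * h x)"
    by blast
qed

section \<open>Factorisation through \<open>\<phi>\<close> and the adjoint of a factored
  function\<close>

text \<open>Induction over nonnegative measurable functions: indicators factor by
  \<open>sets\<close>, and multiples, sums and suprema are formed on the factors. The exceptional
  sets of a sequence form one null set.\<close>

lemma factor_through_phi_ennreal:
  fixes u :: "'a \<Rightarrow> ennreal"
  assumes sets: "\<And>A. A \<in> sets M \<Longrightarrow> \<exists>D\<in>sets M. AE x in M. x \<in> A \<longleftrightarrow> \<phi> x \<in> D"
    and u: "u \<in> borel_measurable M"
  shows "\<exists>v\<in>borel_measurable M. AE x in M. u x = v (\<phi> x)"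
  using u
proof (induction rule: borel_measurable_induct)
  case (cong f g)
  then obtain v where v: "v \<in> borel_measurable M" "AE x in M. g x = v (\<phi> x)" by blast
  have "AE x in M. f x = v (\<phi> x)" using v(2) AE_space by eventually_elim (simp add: cong)
  then show ?case using v(1) by blast
next
  case (set A)
  then obtain D where D: "D \<in> sets M" "AE x in M. x \<in> A \<longleftrightarrow> \<phi> x \<in> D" using sets by blast
  have "AE x in M. (indicator A x :: ennreal) = indicator D (\<phi> x)"
    using D(2) by eventually_elim (auto split: split_indicator)
  then show ?case using D(1) by (intro bexI[of _ "indicator D"]) auto
next
  case (mult u c)
  then obtain v where v: "v \<in> borel_measurable M" "AE x in M. u x = v (\<phi> x)" by blast
  have "AE x in M. c * u x = c * v (\<phi> x)" using v(2) by eventually_elim simp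
  then show ?case using v(1) by (intro bexI[of _ "\<lambda>x. c * v x"]) auto
next
  case (add u w)
  then obtain v v' where v: "v \<in> borel_measurable M" "AE x in M. u x = v (\<phi> x)"
    "v' \<in> borel_measurable M" "AE x in M. w x = v' (\<phi> x)" by blast
  have "AE x in M. w x + u x = v' (\<phi> x) + v (\<phi> x)" using v(2,4) by eventually_elim simp
  then show ?case using v(1,3) by (intro bexI[of _ "\<lambda>x. v' x + v x"]) auto
next
  case (seq U)
  then obtain V where V: "\<And>i. V i \<in> borel_measurable M" "\<And>i. AE x in M. U i x = V i (\<phi> x)"
    by metis
  have "AE x in M. \<forall>i. U i x = V i (\<phi> x)" unfolding AE_all_countable using V(2) by blast
  then have "AE x in M. (SUP i. U i) x = (SUP i. V i (\<phi> x))"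
    by eventually_elim (simp add: image_comp)
  then show ?case using V(1) by (intro bexI[of _ "\<lambda>x. SUP i. V i x"]) auto
qed

lemma factor_through_phi_real:
  fixes u :: "'a \<Rightarrow> real"
  assumes sets: "\<And>A. A \<in> sets M \<Longrightarrow> \<exists>D\<in>sets M. AE x in M. x \<in> A \<longleftrightarrow> \<phi> x \<in> D"
    and [measurable]: "u \<in> borel_measurable M"
  shows "\<exists>v\<in>borel_measurable M. AE x in M. u x = v (\<phi> x)"
proof -
  obtain v where [measurable]: "v \<in> borel_measurable M" and v: "AE x in M. ennreal (u x) = v (\<phi> x)"
    using factor_through_phi_ennreal[OF sets, of "\<lambda>x. ennreal (u x)"] by auto
  obtain w where [measurable]: "w \<in> borel_measurable M" and w: "AE x in M. ennreal (- u x) = w (\<phi> x)"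
    using factor_through_phi_ennreal[OF sets, of "\<lambda>x. ennreal (- u x)"] by auto
  \<comment> \<open>As \<open>ennreal\<close> sends negative reals to zero, the two terms are the
    positive and the negative part of \<open>u x\<close>.\<close>
  have split: "u x = enn2real (ennreal (u x)) - enn2real (ennreal (- u x))" for x
    by (cases "0 \<le> u x") (auto simp: ennreal_neg)
  have "AE x in M. u x = enn2real (v (\<phi> x)) - enn2real (w (\<phi> x))"
    using v w by eventually_elim (metis split)
  then show ?thesis by (intro bexI[of _ "\<lambda>x. enn2real (v x) - enn2real (w x)"]) auto
qed

lemma factor_through_phi:
  fixes u :: "'a \<Rightarrow> complex"
  assumes sets: "\<And>A. A \<in> sets M \<Longrightarrow> \<exists>D\<in>sets M. AE x in M. x \<in> A \<longleftrightarrow> \<phi> x \<in> D"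
    and [measurable]: "u \<in> borel_measurable M"
  shows "\<exists>v\<in>borel_measurable M. AE x in M. u x = v (\<phi> x)"
proof -
  obtain v where [measurable]: "v \<in> borel_measurable M" and v: "AE x in M. Re (u x) = v (\<phi> x)"
    using factor_through_phi_real[OF sets, of "\<lambda>x. Re (u x)"] by auto
  obtain w where [measurable]: "w \<in> borel_measurable M" and w: "AE x in M. Im (u x) = w (\<phi> x)"
    using factor_through_phi_real[OF sets, of "\<lambda>x. Im (u x)"] by auto
  have "AE x in M. u x = of_real (v (\<phi> x)) + \<i> * of_real (w (\<phi> x))"
    using v w by eventually_elim (simp add: complex_eq_iff)
  then show ?thesis by (intro bexI[of _ "\<lambda>x. of_real (v x) + \<i> * of_real (w x)"]) auto
qed

text \<open>With \<open>C\<^sup>*g = hv\<close> this compares the norms of \<open>C\<^sup>*g\<close>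
  and \<open>Cg\<close>. Change of variables is used twice, and invariance of \<open>h\<close> links
  the two uses. The integrals may be infinite, so domains are compared as well.\<close>

lemma nn_integral_h_factor:
  assumes inv: "AE x in M. h (\<phi> x) = h x"
    and [measurable]: "g \<in> borel_measurable M" "v \<in> borel_measurable M"
    and gv: "AE x in M. g x = v (\<phi> x)"
  shows "(\<integral>\<^sup>+x. ennreal ((cmod (of_real (h x) * v x))\<^sup>2) \<partial>M) =
    (\<integral>\<^sup>+x. ennreal ((cmod ((g \<circ> \<phi>) x))\<^sup>2) \<partial>M)"
proof -
  have "(\<integral>\<^sup>+x. ennreal ((cmod (of_real (h x) * v x))\<^sup>2) \<partial>M) =
      (\<integral>\<^sup>+x. ennreal (h x) * ennreal (h x * (cmod (v x))\<^sup>2) \<partial>M)"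
    by (intro nn_integral_cong)
      (simp add: norm_mult h_nonneg power2_eq_square mult_ac flip: ennreal_mult)
  also have "\<dots> = (\<integral>\<^sup>+x. ennreal (h (\<phi> x) * (cmod (v (\<phi> x)))\<^sup>2) \<partial>M)"
    by (rule nn_integral_comp[symmetric]) measurable
  also have "\<dots> = (\<integral>\<^sup>+x. ennreal (h x) * ennreal ((cmod (g x))\<^sup>2) \<partial>M)"
  proof (intro nn_integral_cong_AE)
    show "AE x in M. ennreal (h (\<phi> x) * (cmod (v (\<phi> x)))\<^sup>2) =
        ennreal (h x) * ennreal ((cmod (g x))\<^sup>2)"
      using inv gv by eventually_elim (simp add: h_nonneg ennreal_mult)
  qed
  also have "\<dots> = (\<integral>\<^sup>+x. ennreal ((cmod ((g \<circ> \<phi>) x))\<^sup>2) \<partial>M)"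
    unfolding o_def by (rule nn_integral_comp[symmetric]) measurable
  finally show ?thesis .
qed

lemma h_factor_square_integrable_iff:
  assumes "AE x in M. h (\<phi> x) = h x"
    and [measurable]: "g \<in> borel_measurable M" "v \<in> borel_measurable M"
    and "AE x in M. g x = v (\<phi> x)"
  shows "(\<lambda>x. of_real (h x) * v x) \<in> L \<longleftrightarrow> g \<circ> \<phi> \<in> L"
  unfolding square_integrable_iff_nn nn_integral_h_factor[OF assms] by (simp add: o_def)

text \<open>Cut-off test functions and change of variables identify \<open>k\<close> with
  \<open>hv\<close> before \<open>hv\<close> is known to lie in \<open>L\<close>. Since
  \<open>k\<close> lies in \<open>L\<close>, existence of an adjoint value then forces
  \<open>hv\<close> into \<open>L\<close>.\<close>

lemma adjoint_value_factor:
  assumes v [measurable]: "v \<in> borel_measurable M" and gv: "AE x in M. g x = v (\<phi> x)"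
    and k: "adjoint_value g k"
  shows "AE x in M. k x = of_real (h x) * v x"
proof (rule cut_test_unique)
  have gL: "g \<in> L" and kL: "k \<in> L" using k by (auto simp: adjoint_value_def)
  then show [measurable]: "k \<in> borel_measurable M" by (auto simp: L_measurable)
  have [measurable]: "g \<in> borel_measurable M" using gL by (rule L_measurable)
  show "(\<lambda>x. complex_of_real (h x) * v x) \<in> borel_measurable M" by measurable
  fix E assume E: "bounded_set E"
  then have [measurable]: "E \<in> sets M" by (simp add: bounded_set_def)
  show "(\<lambda>x. indicator E x * k x) \<in> L" by (rule cut_square_integrable[OF E kL])
  obtain c where c: "\<And>x. x \<in> E \<Longrightarrow> h x \<le> c" using E by (auto simp: bounded_set_def)
  \<comment> \<open>On \<open>E\<close> one of the two factors \<open>h\<close> is bounded by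
    \<open>c\<close>; the other one is absorbed by change of variables, which leaves the finite
    integral of \<open>(cmod (g x))\<^sup>2\<close>.\<close>
  have "(\<integral>\<^sup>+x. ennreal ((cmod (indicator E x * (of_real (h x) * v x)))\<^sup>2) \<partial>M)
      \<le> (\<integral>\<^sup>+x. ennreal c * (ennreal (h x) * ennreal ((cmod (v x))\<^sup>2)) \<partial>M)"
  proof (intro nn_integral_mono)
    fix x
    have "h x * (h x * (cmod (v x))\<^sup>2) \<le> c * (h x * (cmod (v x))\<^sup>2)" if "x \<in> E"
      using c[OF that] by (intro mult_right_mono) (auto simp: h_nonneg)
    moreover have "0 \<le> c" if "x \<in> E" using c[OF that] h_nonneg[of x] by linarith
    ultimately show "ennreal ((cmod (indicator E x * (of_real (h x) * v x)))\<^sup>2)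
        \<le> ennreal c * (ennreal (h x) * ennreal ((cmod (v x))\<^sup>2))"
      by (auto simp: norm_mult h_nonneg power2_eq_square mult_ac split: split_indicator
          simp flip: ennreal_mult intro!: ennreal_leI)
  qed
  also have "\<dots> = ennreal c * (\<integral>\<^sup>+x. ennreal ((cmod (v (\<phi> x)))\<^sup>2) \<partial>M)"
    using nn_integral_comp[of "\<lambda>x. ennreal ((cmod (v x))\<^sup>2)"] by (simp add: nn_integral_cmult)
  also have "(\<integral>\<^sup>+x. ennreal ((cmod (v (\<phi> x)))\<^sup>2) \<partial>M) = (\<integral>\<^sup>+x. ennreal ((cmod (g x))\<^sup>2) \<partial>M)"
    by (intro nn_integral_cong_AE) (use gv in \<open>auto elim!: eventually_mono\<close>)
  also have "ennreal c * \<dots> < \<infinity>"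
    using gL by (simp add: square_integrable_iff_nn ennreal_mult_less_top)
  finally show "(\<lambda>x. indicator E x * (complex_of_real (h x) * v x)) \<in> L"
    by (simp add: square_integrable_iff_nn)
  fix u assume u: "u \<in> L"
  then have [measurable]: "u \<in> borel_measurable M" by (rule L_measurable)
  have "(LINT x|M. indicator E x * u x * cnj (k x)) =
      (LINT x|M. indicator E (\<phi> x) * u (\<phi> x) * cnj (g x))"
    using adjoint_value_cut[OF k E u] by simp
  also have "\<dots> = (LINT x|M. indicator E (\<phi> x) * u (\<phi> x) * cnj (v (\<phi> x)))"
    by (rule integral_cong_AE) (use gv in \<open>auto elim!: eventually_mono\<close>)
  also have "\<dots> = (LINT x|M. of_real (h x) * (indicator E x * u x * cnj (v x)))"
    using integral_comp[of "\<lambda>x. indicator E x * u x * cnj (v x)"]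
    by (simp add: scaleR_conv_of_real)
  finally show "(LINT x|M. indicator E x * u x * cnj (k x)) =
      (LINT x|M. indicator E x * u x * cnj (complex_of_real (h x) * v x))"
    by (simp add: mult_ac)
qed

lemma adjoint_value_factorI:
  assumes [measurable]: "v \<in> borel_measurable M" and gv: "AE x in M. g x = v (\<phi> x)"
    and g: "g \<in> L" and hv: "(\<lambda>x. of_real (h x) * v x) \<in> L"
  shows "adjoint_value g (\<lambda>x. of_real (h x) * v x)"
proof -
  have [measurable]: "g \<in> borel_measurable M" using g by (rule L_measurable)
  have "v \<circ> \<phi> \<in> L"
    by (rule square_integrable_cong_AE[OF g]) (use gv in \<open>auto simp: o_def\<close>)
  then have "adjoint_value (v \<circ> \<phi>) (\<lambda>x. of_real (h x) * v x)"
    by (intro adjoint_value_comp hv) measurable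
  then show ?thesis
    by (rule adjoint_value_cong) (use gv in \<open>auto elim!: eventually_mono\<close>)
qed

section \<open>From indicators back to both notions of normality\<close>

text \<open>Every \<open>f\<close> in the domain factors as \<open>v \<circ> \<phi>\<close>, so
  \<open>C\<^sup>*f = hv\<close>, whose norm is that of \<open>f \<circ> \<phi>\<close>.\<close>

lemma normal_on_indicators_imp_formally_normal:
  assumes N: normal_on_indicators
    and dense: "densely_defined (L2_space M) (composition_operator M \<phi>)"
  shows "formally_normal_operator (L2_space M) (composition_operator M \<phi>)"
proof -
  let ?C = "composition_operator M \<phi>" let ?A = "adjoint_operator (L2_space M) ?C"
  have "F \<in> dom ?A \<and> vnorm (L2_space M) (the (?C F)) = vnorm (L2_space M) (the (?A F))"
    if "F \<in> dom ?C" for F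
  proof -
    from that obtain f where f: "f \<in> L" "f \<circ> \<phi> \<in> L" "F = ae_class M f"
      "?C F = Some (ae_class M (f \<circ> \<phi>))"
      by (rule composition_operator_domE[OF nonsingular])
    have [measurable]: "f \<in> borel_measurable M" using f(1) by (rule L_measurable)
    obtain v where v [measurable]: "v \<in> borel_measurable M" and fv: "AE x in M. f x = v (\<phi> x)"
      using factor_through_phi[OF set_is_preimage[OF N], of f] by auto
    note fac = h_invariant[OF N] \<open>f \<in> borel_measurable M\<close> v fv
    have hv: "(\<lambda>x. of_real (h x) * v x) \<in> L"
      using h_factor_square_integrable_iff[OF fac] f(2) by simp
    have A: "?A F = Some (ae_class M (\<lambda>x. of_real (h x) * v x))"
      using adjoint_value_factorI[OF v fv f(1) hv] adjoint_eq_Some_iff[OF f(1) hv] f(3) by simp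
    have "(LINT x|M. (cmod (of_real (h x) * v x))\<^sup>2) = (LINT x|M. (cmod ((f \<circ> \<phi>) x))\<^sup>2)"
      using nn_integral_h_factor[OF fac] by (subst (1 2) integral_eq_nn_integral) (auto simp: o_def)
    then show ?thesis
      unfolding f(4) A option.sel vnorm_ae_class[OF f(2)] vnorm_ae_class[OF hv] using A by auto
  qed
  then show ?thesis using dense unfolding formally_normal_operator_def by blast
qed

text \<open>Writing \<open>f\<close> as \<open>v \<circ> \<phi>\<close>, both products send
  \<open>f\<close> to \<open>hf\<close>. Equality of partial functions includes equality of domains,
  hence the case distinctions.\<close>

lemma normal_on_indicators_imp_normal:
  assumes N: normal_on_indicators
    and dense: "densely_defined (L2_space M) (composition_operator M \<phi>)"
  shows "normal_operator (L2_space M) (composition_operator M \<phi>)"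
proof -
  let ?C = "composition_operator M \<phi>" let ?A = "adjoint_operator (L2_space M) ?C"
  have "(?A \<circ>\<^sub>m ?C) F = (?C \<circ>\<^sub>m ?A) F" for F
  proof (cases "F \<in> vecs (L2_space M)")
    case False
    then have "?C F = None" "?A F = None"
      by (auto simp: composition_operator_def adjoint_operator_def)
    then show ?thesis by (simp add: map_comp_def)
  next
    case True
    then obtain f where f: "f \<in> L" and F: "F = ae_class M f" by (rule L2_space_cases)
    have [measurable]: "f \<in> borel_measurable M" using f by (rule L_measurable)
    obtain v where v [measurable]: "v \<in> borel_measurable M" and fv: "AE x in M. f x = v (\<phi> x)"
      using factor_through_phi[OF set_is_preimage[OF N], of f] by auto
    let ?hf = "\<lambda>x. complex_of_real (h x) * f x" and ?hv = "\<lambda>x. complex_of_real (h x) * v x"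
    have hv_iff: "?hv \<in> L \<longleftrightarrow> f \<circ> \<phi> \<in> L"
      by (rule h_factor_square_integrable_iff[OF h_invariant[OF N] _ v fv]) measurable
    have hvhf: "AE x in M. ?hv (\<phi> x) = ?hf x"
      using h_invariant[OF N] fv by eventually_elim simp
    show ?thesis
    \<comment> \<open>This condition describes the domain of either product.\<close>
    proof (cases "f \<circ> \<phi> \<in> L \<and> ?hf \<in> L")
      case True
      then have hv: "?hv \<in> L" using hv_iff by simp
      have "?C F = Some (ae_class M (f \<circ> \<phi>))"
        using True by (simp add: F composition_operator_ae_class[OF nonsingular f])
      moreover have "?A (ae_class M (f \<circ> \<phi>)) = Some (ae_class M ?hf)"
        using True by (intro iffD2[OF adjoint_eq_Some_iff] adjoint_value_comp) simp_all
      moreover have "?A F = Some (ae_class M ?hv)"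
        unfolding F by (rule iffD2[OF adjoint_eq_Some_iff[OF f hv] adjoint_value_factorI[OF v fv f hv]])
      moreover have "?C (ae_class M ?hv) = Some (ae_class M ?hf)"
        using True by (intro iffD2[OF composition_operator_eq_Some_iff[OF nonsingular hv] hvhf]) simp
      ultimately show ?thesis by (simp add: map_comp_def)
    next
      case False
      have "(?A \<circ>\<^sub>m ?C) F = None"
      proof (rule ccontr)
        assume "(?A \<circ>\<^sub>m ?C) F \<noteq> None"
        then obtain K where "(?A \<circ>\<^sub>m ?C) F = Some K" by (elim not_None_eq[THEN iffD1, THEN exE])
        then have fphi: "f \<circ> \<phi> \<in> L" and "?A (ae_class M (f \<circ> \<phi>)) = Some K"
          by (auto simp: F map_comp_def composition_operator_ae_class[OF nonsingular f] split: if_splits)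
        then obtain k where k: "adjoint_value (f \<circ> \<phi>) k" using adjoint_dom_iff[OF fphi] by blast
        then have kL: "k \<in> L" by (simp add: adjoint_value_def)
        \<comment> \<open>Here \<open>f\<close> itself is the factor of
          \<open>f \<circ> \<phi>\<close> through \<open>\<phi>\<close>.\<close>
        have khf: "AE x in M. k x = ?hf x"
          by (rule adjoint_value_factor[where v = f, OF _ _ k]) simp_all
        have "?hf \<in> L" by (rule square_integrable_cong_AE[OF kL _ khf]) measurable
        then show False using False fphi by simp
      qed
      moreover have "(?C \<circ>\<^sub>m ?A) F = None"
      proof (rule ccontr)
        assume "(?C \<circ>\<^sub>m ?A) F \<noteq> None"
        then obtain K where "(?C \<circ>\<^sub>m ?A) F = Some K" by (elim not_None_eq[THEN iffD1, THEN exE])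
        then obtain K' where K': "?A F = Some K'" "?C K' = Some K"
          by (auto simp: map_comp_def split: option.splits)
        then obtain k where k: "adjoint_value f k" using adjoint_dom_iff[OF f] F by blast
        then have kL: "k \<in> L" by (simp add: adjoint_value_def)
        then have [measurable]: "k \<in> borel_measurable M" by (rule L_measurable)
        have khv: "AE x in M. k x = ?hv x" by (rule adjoint_value_factor[OF v fv k])
        have "?hv \<in> L" by (rule square_integrable_cong_AE[OF kL _ khv]) measurable
        then have fphi: "f \<circ> \<phi> \<in> L" using hv_iff by simp
        have "K' = ae_class M k" using adjoint_eq_Some_iff[OF f kL] k K'(1) F by simp
        then have kphi: "k \<circ> \<phi> \<in> L"
          using K'(2) by (auto simp: composition_operator_ae_class[OF nonsingular kL] split: if_splits)
        \<comment> \<open>Composing with \<open>\<phi>\<close> and using invariance of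
          \<open>h\<close> identifies \<open>k \<circ> \<phi>\<close>, which lies in
          \<open>L\<close>, with \<open>hf\<close>.\<close>
        have "AE x in M. k (\<phi> x) = ?hv (\<phi> x)" by (rule AE_nonsingular[OF nonsingular khv])
        then have khf: "AE x in M. (k \<circ> \<phi>) x = ?hf x" using hvhf by eventually_elim simp
        have "?hf \<in> L" by (rule square_integrable_cong_AE[OF kphi _ khf]) measurable
        then show False using False fphi by simp
      qed
      ultimately show ?thesis by simp
    qed
  qed
  then have "?A \<circ>\<^sub>m ?C = ?C \<circ>\<^sub>m ?A" by (rule ext)
  then show ?thesis
    using dense closed_composition_operator[OF nonsingular] by (simp add: normal_operator_def)
qed

end

section \<open>Finiteness of the density and the equivalence\<close>

text \<open>A function in the domain vanishes where the Radon--Nikodym derivative is infinite, so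
  indicators of subsets of finite measure of that set stay away from the domain.\<close>

lemma dense_imp_RN_deriv_finite:
  assumes "sigma_finite_measure M" and \<phi>: "nonsingular_transformation M \<phi>"
    and dense: "densely_defined (L2_space M) (composition_operator M \<phi>)"
  shows "AE x in M. RN_deriv M (distr M M \<phi>) x \<noteq> \<infinity>"
proof -
  interpret sigma_finite_measure M by fact
  let ?H = "RN_deriv M (distr M M \<phi>)"
  have phi [measurable]: "\<phi> \<in> M \<rightarrow>\<^sub>M M" and ac: "absolutely_continuous M (distr M M \<phi>)"
    using \<phi> by (auto simp: nonsingular_transformation_def)
  obtain A :: "nat \<Rightarrow> 'a set"
    where A: "range A \<subseteq> sets M" "(\<Union>i. A i) = space M" "\<And>i. emeasure M (A i) \<noteq> \<infinity>"
    using sigma_finite by blast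
  have [measurable]: "A i \<in> sets M" for i using A(1) by auto
  have vanish: "AE x in M. ?H x = \<infinity> \<longrightarrow> f x = 0"
    if f: "f \<in> square_integrable M" "f \<circ> \<phi> \<in> square_integrable M" for f
  proof -
    have [measurable]: "f \<in> borel_measurable M" using f(1) by (simp add: square_integrable_def)
    have "(\<integral>\<^sup>+x. ?H x * ennreal ((cmod (f x))\<^sup>2) \<partial>M) = (\<integral>\<^sup>+x. ennreal ((cmod (f x))\<^sup>2) \<partial>distr M M \<phi>)"
      using RN_deriv_nn_integral[OF ac] by simp
    also have "\<dots> < \<infinity>" using f(2) by (simp add: nn_integral_distr square_integrable_iff_nn)
    finally have "AE x in M. ?H x * ennreal ((cmod (f x))\<^sup>2) \<noteq> \<infinity>"
      by (intro nn_integral_PInf_AE) auto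
    then show ?thesis by eventually_elim (auto simp: ennreal_top_mult split: if_splits)
  qed
  have "AE x in M. x \<in> A i \<longrightarrow> ?H x \<noteq> \<infinity>" for i
  proof -
    define Y where "Y = A i \<inter> {x \<in> space M. ?H x = \<infinity>}"
    have Y [measurable]: "Y \<in> sets M" unfolding Y_def by measurable
    have fin: "emeasure M Y < \<infinity>"
      using emeasure_mono[of Y "A i" M] A(3)[of i] by (auto simp: Y_def top.not_eq_extremum intro: le_less_trans)
    then have g: "indicator Y \<in> square_integrable M" by (intro indicator_square_integrable) auto
    have "measure M Y = 0"
    proof (rule ccontr)
      assume "measure M Y \<noteq> 0"
      \<comment> \<open>The radius is the norm of the indicator of \<open>Y\<close>. Functions in
        the domain vanish almost everywhere on \<open>Y\<close>, so none of them can be closer to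
        the indicator than this.\<close>
      then have "0 < sqrt (measure M Y)" by (simp add: zero_less_measure_iff)
      then obtain F where "F \<in> dom (composition_operator M \<phi>)"
        and F: "vdist (L2_space M) F (ae_class M (indicator Y)) < sqrt (measure M Y)"
        using dense ae_class_in_L2[OF g] unfolding densely_defined_def by blast
      then obtain f where f: "f \<in> square_integrable M" "f \<circ> \<phi> \<in> square_integrable M" "F = ae_class M f"
        by (elim composition_operator_domE[OF \<phi>])
      have "measure M Y = (LINT x|M. indicator Y x)" by simp
      also have "\<dots> \<le> (LINT x|M. (cmod (f x - indicator Y x))\<^sup>2)"
      proof (rule integral_mono_AE)
        show "integrable M (indicator Y :: _ \<Rightarrow> real)" using fin by simp
        show "integrable M (\<lambda>x. (cmod (f x - indicator Y x))\<^sup>2)"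
          using square_integrable_diff[OF f(1) g] by (simp add: square_integrable_def)
        show "AE x in M. indicator Y x \<le> (cmod (f x - indicator Y x))\<^sup>2"
          using vanish[OF f(1,2)] by eventually_elim (auto simp: Y_def split: split_indicator)
      qed
      finally show False using F by (simp add: f(3) vdist_ae_class[OF f(1) g])
    qed
    then have "emeasure M Y = 0" using fin by (simp add: emeasure_eq_ennreal_measure)
    then have "Y \<in> null_sets M" using Y by blast
    from AE_not_in[OF this] AE_space[of M] show ?thesis
      by eventually_elim (auto simp: Y_def)
  qed
  then have "AE x in M. \<forall>i. x \<in> A i \<longrightarrow> ?H x \<noteq> \<infinity>"
    unfolding AE_all_countable by blast
  then show ?thesis using AE_space by eventually_elim (use A(2) in blast)
qed

theorem theorem9p4:
  fixes M :: "'a measure" and \<phi> :: "'a \<Rightarrow> 'a"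
  assumes "sigma_finite_measure M" and "nonsingular_transformation M \<phi>"
  shows "normal_operator (L2_space M) (composition_operator M \<phi>) \<longleftrightarrow>
         formally_normal_operator (L2_space M) (composition_operator M \<phi>)"
proof (cases "densely_defined (L2_space M) (composition_operator M \<phi>)")
  \<comment> \<open>Both notions include being densely defined, so both fail here.\<close>
  case False
  then show ?thesis by (simp add: normal_operator_def formally_normal_operator_def)
next
  case True
  let ?H = "RN_deriv M (distr M M \<phi>)"
  interpret sigma_finite_measure M by fact
  have "distr M M \<phi> = density M ?H"
    using assms(2) by (simp add: density_RN_deriv nonsingular_transformation_def)
  \<comment> \<open>As \<open>enn2real\<close> sends infinity to zero, the density changes only on
    the set where it is infinite, which is null.\<close>
  also have "\<dots> = density M (\<lambda>x. ennreal (enn2real (?H x)))"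
    using dense_imp_RN_deriv_finite[OF assms True]
    by (intro density_cong) (auto elim!: eventually_mono simp: less_top)
  finally interpret composition_density M \<phi> "\<lambda>x. enn2real (?H x)"
    by unfold_locales (use assms(2) in auto)
  show ?thesis
    using True normal_imp_normal_on_indicators normal_on_indicators_imp_normal
      formally_normal_imp_normal_on_indicators normal_on_indicators_imp_formally_normal
    by blast
qed

end
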